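(* For each $n\ge 1$ let $(\xi_{n,i})_{1\le i\le n}$ be a (possibly non-homogeneous) Markov chain and let $X_{n,i}=f_{n,i}(\xi_{n,i})$, $1\le i\le n$, where the $f_{n,i}$ are real-valued measurable functions, with $\mathbf{E}X_{n,i}=0$ and $\mathbf{E}X_{n,i}^2<\infty$. Let $\lambda_n$, $\sigma_n$, $b_n$ be as in the context, and assume $\lambda_n b_n>0$ for all $n\ge 1$. Assume that there are two positive constants $C$ and $c$ such that $\max_{1\le i\le n}|X_{n,i}|\le C$ a.s. and $\mathrm{var}\,X_{n,i}\ge c>0$ for all $n\ge 1$ and $1\le i\le n$. If $$\lambda_n^3\, n\,(1+|\ln(\lambda_n)|)^{-2}\to\infty\quad\text{as } n\to\infty,$$ then $$\frac{\sum_{i=1}^n X_{n,i}}{\sigma_n}\to N(0,1)\quad\text{in distribution as } n\to\infty.$$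
   Context: All Markov chains are defined on a probability space $(\Omega,\mathcal{K},\mathbf{P})$ and take values in a measurable space $(\mathcal{X},\mathcal{B}(\mathcal{X}))$. For sub-$\sigma$-algebras $\mathcal{A},\mathcal{B}$ of $\mathcal{K}$, the maximal coefficient of correlation is $$\rho(\mathcal{A},\mathcal{B})=\sup_{f\in \mathbf{L}_2(\mathcal{A}),\,g\in \mathbf{L}_2(\mathcal{B})}|\mathrm{corr}(f,g)|,$$ where $\mathbf{L}_2(\mathcal{A})$ is the space of square integrable $\mathcal{A}$-measurable random variables (the correlation is taken to be $0$ if one of the variables is a.s. constant). Define $\rho_{n,1}=\max_{1\le s\le n-1}\rho(\sigma(\xi_{n,s}),\sigma(\xi_{n,s+1}))$ (with $\rho_{1,1}=0$) and $\lambda_n=1-\rho_{n,1}$. Put $S_n=\sum_{i=1}^n X_{n,i}$, $\sigma_n^2=\mathrm{var}\,S_n$, $b_n^2=\sum_{i=1}^n \mathrm{var}\,X_{n,i}$, with $\sigma_n,b_n\ge 0$. The condition $\lambda_n b_n>0$ is equivalent to $\lambda_n\sigma_n>0$. $N(0,1)$ is the standard normal law. *)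

theory Defs
  imports "HOL-Probability.Probability"
begin

definition sigma_alg_of_family ::
    "'a measure \<Rightarrow> 'b measure \<Rightarrow> ('i \<Rightarrow> 'a \<Rightarrow> 'b) \<Rightarrow> 'i set \<Rightarrow> 'a measure" where
  "sigma_alg_of_family M S \<xi> I =
     sigma (space M) {\<xi> i -` A \<inter> space M | i A. i \<in> I \<and> A \<in> sets S}"

text \<open>
  A (possibly non-homogeneous) Markov chain \<open>\<xi> 1, \<dots>, \<xi> n\<close> with state space \<open>S\<close>; the values
  of \<open>\<xi>\<close> at other indices are irrelevant. Sub-sigma-algebras are represented by measures on
  the same space, of which only the measurable sets matter.
\<close>

definition markov_chain :: "'a measure \<Rightarrow> 'b measure \<Rightarrow> nat \<Rightarrow> (nat \<Rightarrow> 'a \<Rightarrow> 'b) \<Rightarrow> bool" where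
  "markov_chain M S n \<xi> \<longleftrightarrow>
     (\<forall>i\<in>{1..n}. \<xi> i \<in> measurable M S) \<and>
     (\<forall>i. 1 \<le> i \<and> i < n \<longrightarrow> (\<forall>A\<in>sets S. AE \<omega> in M.
        real_cond_exp M (sigma_alg_of_family M S \<xi> {1..i})
          (indicator (\<xi> (Suc i) -` A \<inter> space M)) \<omega> =
        real_cond_exp M (vimage_algebra (space M) (\<xi> i) S)
          (indicator (\<xi> (Suc i) -` A \<inter> space M)) \<omega>))"

definition L2_space :: "'a measure \<Rightarrow> 'a measure \<Rightarrow> ('a \<Rightarrow> real) set" where
  "L2_space M \<A> = {f \<in> borel_measurable \<A>. integrable M (\<lambda>\<omega>. (f \<omega>)\<^sup>2)}"

definition covariance :: "'a measure \<Rightarrow> ('a \<Rightarrow> real) \<Rightarrow> ('a \<Rightarrow> real) \<Rightarrow> real" where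
  "covariance M f g = prob_space.expectation M
     (\<lambda>\<omega>. (f \<omega> - prob_space.expectation M f) * (g \<omega> - prob_space.expectation M g))"

text \<open>
  Since \<open>x / 0 = 0\<close>, the correlation is \<open>0\<close> when one of the variables is almost surely constant.
\<close>

definition corr :: "'a measure \<Rightarrow> ('a \<Rightarrow> real) \<Rightarrow> ('a \<Rightarrow> real) \<Rightarrow> real" where
  "corr M f g = covariance M f g /
     (sqrt (prob_space.variance M f) * sqrt (prob_space.variance M g))"

definition max_corr :: "'a measure \<Rightarrow> 'a measure \<Rightarrow> 'a measure \<Rightarrow> real" where
  "max_corr M \<A> \<B> = (SUP (f, g) \<in> L2_space M \<A> \<times> L2_space M \<B>. \<bar>corr M f g\<bar>)"

definition chain_rho :: "'a measure \<Rightarrow> 'b measure \<Rightarrow> nat \<Rightarrow> (nat \<Rightarrow> 'a \<Rightarrow> 'b) \<Rightarrow> real" where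
  "chain_rho M S n \<xi> =
     (if n \<le> 1 then 0
      else MAX s\<in>{1..n - 1}. max_corr M
             (vimage_algebra (space M) (\<xi> s) S) (vimage_algebra (space M) (\<xi> (Suc s)) S))"

text \<open>
  The next two lemmas show that the supremum in \<open>max_corr\<close> is over a nonempty set bounded by
  \<open>1\<close>, so that the conditionally complete \<open>Sup\<close> on the reals is the true supremum.
\<close>

lemma zero_in_L2_space: "(\<lambda>_. 0) \<in> L2_space M \<A>"
  by (simp add: L2_space_def)

lemma abs_corr_le_1:
  assumes "prob_space M" "subalgebra M \<A>" "subalgebra M \<B>"
    and f: "f \<in> L2_space M \<A>" and g: "g \<in> L2_space M \<B>"
  shows "\<bar>corr M f g\<bar> \<le> 1"
proof -
  interpret prob_space M by fact
  have meas: "f \<in> borel_measurable M" "g \<in> borel_measurable M"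
    using assms measurable_from_subalg by (auto simp: L2_space_def)
  have sq: "integrable M (\<lambda>\<omega>. (f \<omega>)\<^sup>2)" "integrable M (\<lambda>\<omega>. (g \<omega>)\<^sup>2)"
    using f g by (auto simp: L2_space_def)
  have int: "integrable M f" "integrable M g"
    using square_integrable_imp_integrable meas sq by blast+
  define F where "F = (\<lambda>\<omega>. f \<omega> - expectation f)"
  define G where "G = (\<lambda>\<omega>. g \<omega> - expectation g)"
  have Fm[measurable]: "F \<in> borel_measurable M" and Gm[measurable]: "G \<in> borel_measurable M"
    using meas by (auto simp: F_def G_def)
  have F2: "integrable M (\<lambda>\<omega>. (F \<omega>)\<^sup>2)" and G2: "integrable M (\<lambda>\<omega>. (G \<omega>)\<^sup>2)"
    using sq int by (auto simp: F_def G_def power2_diff)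
  define a where "a = sqrt (expectation (\<lambda>\<omega>. (F \<omega>)\<^sup>2))"
  define b where "b = sqrt (expectation (\<lambda>\<omega>. (G \<omega>)\<^sup>2))"
  have corr: "corr M f g = expectation (\<lambda>\<omega>. F \<omega> * G \<omega>) / (a * b)"
    by (simp add: corr_def covariance_def F_def G_def a_def b_def)
  show ?thesis
  proof (cases "a = 0 \<or> b = 0")
    case True
    then show ?thesis unfolding corr by auto
  next
    case False
    have a0: "a > 0" and b0: "b > 0" using False by (auto simp: a_def b_def less_le)
    have a2: "expectation (\<lambda>\<omega>. (F \<omega>)\<^sup>2) = a\<^sup>2" and b2: "expectation (\<lambda>\<omega>. (G \<omega>)\<^sup>2) = b\<^sup>2"
      by (simp_all add: a_def b_def)
    let ?h = "\<lambda>\<omega>. ((F \<omega>)\<^sup>2 / a\<^sup>2 + (G \<omega>)\<^sup>2 / b\<^sup>2) / 2"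
    have hint: "integrable M ?h" using F2 G2 by auto
    have le: "norm (F \<omega> * G \<omega> / (a * b)) \<le> ?h \<omega>" for \<omega>
      using sum_squares_bound[of "\<bar>F \<omega> / a\<bar>" "\<bar>G \<omega> / b\<bar>"] a0 b0
      by (simp add: abs_mult power_divide mult_ac)
    have "integrable M (\<lambda>\<omega>. F \<omega> * G \<omega> / (a * b))"
      by (rule Bochner_Integration.integrable_bound[OF hint]) (use le order_trans in \<open>auto intro!: AE_I2\<close>)
    then have "expectation (\<lambda>\<omega>. norm (F \<omega> * G \<omega> / (a * b))) \<le> expectation ?h"
      using hint le by (intro integral_mono) (auto simp del: real_norm_def)
    then have "norm (expectation (\<lambda>\<omega>. F \<omega> * G \<omega> / (a * b))) \<le> expectation ?h"
      by (rule order_trans[OF integral_norm_bound])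
    also have "expectation ?h = 1"
      using F2 G2 a0 b0 by (simp add: a2 b2)
    finally show ?thesis by (simp add: corr)
  qed
qed

end

theory Submission
  imports Defs
begin

text \<open>
  Let \<open>E\<^sub>k\<close> be the conditional expectation given the chain up to time \<open>k\<close>. The maximal correlation
  contracts: \<open>E\<^sub>k X\<^sub>i\<close> is bounded by \<open>C\<close> and has \<open>L\<^sub>2\<close> norm at most \<open>C r\<^sup>i\<^sup>-\<^sup>k\<close>, where
  \<open>r = 1 - \<lambda>\<close>. For \<open>m\<close> of order \<open>ln n / \<lambda>\<close>, \<open>E\<^sub>k X\<^sub>i\<close> with \<open>i - k > m\<close> is therefore negligible, and up to
  a negligible error the sum \<open>S\<close> is a martingale with differences
  \<open>D\<^sub>k = \<Sum>i\<le>k+m. E\<^sub>k X\<^sub>i - E\<^sub>k\<^sub>-\<^sub>1 X\<^sub>i\<close> bounded by \<open>2 C (m + 1)\<close>. The quadratic variation concentrates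
  because \<open>D\<^sub>k\<close> summed over an interval of length \<open>m\<close> telescopes to something of order \<open>C m\<close>, while
  terms at distance more than \<open>m\<close> are nearly uncorrelated. Since \<open>var S \<ge> \<lambda> c n / 4\<close>, all error terms in
  McLeish's proof of the martingale central limit theorem are of order \<open>m / \<sigma>\<close>, that is
  \<open>ln n / (\<lambda>\<^sup>3 n)\<^sup>1\<^sup>/\<^sup>2\<close>, and the hypothesis makes this tend to \<open>0\<close>.
\<close>

subsection \<open>Characteristic functions of bounded martingales\<close>

text \<open>Maximal correlation controls \<open>L2\<close> norms only: the projection
  \<open>E_k X_i\<close> need not become uniformly small as \<open>i - k\<close> grows. So the
  untruncated differences have no uniform bound better than of order \<open>n C\<close>, while
  McLeish's estimate needs a good one. Truncation at \<open>m\<close> supplies it, at the price of a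
  remainder that is small in \<open>L1\<close>. Comparing second moments multiplies this remainder
  by the crude bound of order \<open>n C\<close> for the sums, whence the requirement
  \<open>n^2 r^m \<le> 1\<close>; as \<open>r \<le> exp (- \<lambda>)\<close>, \<open>m\<close>
  about \<open>2 ln n / \<lambda>\<close> suffices. The hypothesis involves
  \<open>ln \<lambda>\<close>, not \<open>ln n\<close>. With
  \<open>y = \<lambda>^3 n / (1 + |ln \<lambda>|)^2\<close>, \<open>ln n\<close> exceeds
  \<open>ln y\<close> by at most a multiple of \<open>1 + |ln \<lambda>|\<close>, and this factor
  cancels against the one in \<open>sqrt y\<close>. Conditional expectations are determined only up
  to null sets. To keep bounds pointwise, they enter as bounded functions characterised by
  expectations of products with bounded test functions; \<open>bdd_meas\<close> collects
  these.\<close>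

definition bdd_meas :: "'a measure \<Rightarrow> ('a \<Rightarrow> real) set" where
  "bdd_meas N = {g \<in> borel_measurable N. \<exists>K. \<forall>x. \<bar>g x\<bar> \<le> K}"

lemma bdd_measI: "g \<in> borel_measurable N \<Longrightarrow> (\<And>x. \<bar>g x\<bar> \<le> K) \<Longrightarrow> g \<in> bdd_meas N"
  by (auto simp: bdd_meas_def)

lemma bdd_meas_measurable: "g \<in> bdd_meas N \<Longrightarrow> g \<in> borel_measurable N"
  by (auto simp: bdd_meas_def)

lemma bdd_meas_const [intro, simp]: "(\<lambda>_. c) \<in> bdd_meas N"
  by (auto simp: bdd_meas_def)

lemma bdd_meas_add [intro]:
  assumes "f \<in> bdd_meas N" "g \<in> bdd_meas N" shows "(\<lambda>x. f x + g x) \<in> bdd_meas N"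
proof -
  obtain K L where "\<And>x. \<bar>f x\<bar> \<le> K" "\<And>x. \<bar>g x\<bar> \<le> L" using assms by (auto simp: bdd_meas_def)
  then show ?thesis using assms
    by (intro bdd_measI[where K = "K + L"]) (auto simp: bdd_meas_def intro!: order_trans[OF abs_triangle_ineq] add_mono)
qed

lemma bdd_meas_mult [intro]:
  assumes "f \<in> bdd_meas N" "g \<in> bdd_meas N" shows "(\<lambda>x. f x * g x) \<in> bdd_meas N"
proof -
  obtain K L where "\<And>x. \<bar>f x\<bar> \<le> K" "\<And>x. \<bar>g x\<bar> \<le> L" using assms by (auto simp: bdd_meas_def)
  then have "\<bar>f x * g x\<bar> \<le> K * L" for x
    by (metis abs_ge_zero abs_mult mult_mono order_trans)
  then show ?thesis using assms by (intro bdd_measI[where K = "K * L"]) (auto simp: bdd_meas_def)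
qed

lemma bdd_meas_diff [intro]:
  assumes "f \<in> bdd_meas N" "g \<in> bdd_meas N" shows "(\<lambda>x. f x - g x) \<in> bdd_meas N"
  using bdd_meas_add[OF assms(1) bdd_meas_mult[OF bdd_meas_const[of "-1"] assms(2)]] by simp

lemma bdd_meas_power2 [intro]: "f \<in> bdd_meas N \<Longrightarrow> (\<lambda>x. (f x)\<^sup>2) \<in> bdd_meas N"
  unfolding power2_eq_square by (rule bdd_meas_mult)

lemma bdd_meas_sum [intro]:
  "(\<And>i. i \<in> I \<Longrightarrow> f i \<in> bdd_meas N) \<Longrightarrow> (\<lambda>x. \<Sum>i\<in>I. f i x) \<in> bdd_meas N"
  by (induction I rule: infinite_finite_induct) auto

lemma bdd_meas_abs [intro]: "f \<in> bdd_meas N \<Longrightarrow> (\<lambda>x. \<bar>f x\<bar>) \<in> bdd_meas N"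
  by (auto simp: bdd_meas_def)

lemma bdd_meas_subalgebra: "subalgebra N F \<Longrightarrow> g \<in> bdd_meas F \<Longrightarrow> g \<in> bdd_meas N"
  using measurable_from_subalg by (auto simp: bdd_meas_def)

lemma (in finite_measure) bdd_meas_integrable [intro]: "g \<in> bdd_meas M \<Longrightarrow> integrable M g"
  by (auto simp: bdd_meas_def intro!: integrable_const_bound AE_I2)

lemma (in prob_space) expectation_abs_le_sqrt:
  assumes "f \<in> bdd_meas M"
  shows "expectation (\<lambda>x. \<bar>f x\<bar>) \<le> sqrt (expectation (\<lambda>x. (f x)\<^sup>2))"
proof -
  have "0 \<le> variance (\<lambda>x. \<bar>f x\<bar>)" by (rule variance_positive)
  also have "variance (\<lambda>x. \<bar>f x\<bar>) = expectation (\<lambda>x. (\<bar>f x\<bar>)\<^sup>2) - (expectation (\<lambda>x. \<bar>f x\<bar>))\<^sup>2"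
    by (rule variance_eq) (use assms in auto)
  finally show ?thesis by (intro real_le_rsqrt) simp
qed

section \<open>Exponential estimates for McLeish's product\<close>

lemma cmod_one_plus_ii_le:
  fixes x :: real
  shows "cmod (1 + \<i> * x) \<le> exp (x\<^sup>2 / 2)"
proof -
  have "1 + x\<^sup>2 \<le> exp (x\<^sup>2)" by (rule exp_ge_add_one_self)
  then have "sqrt (1 + x\<^sup>2) \<le> sqrt ((exp (x\<^sup>2 / 2))\<^sup>2)"
    by (simp flip: exp_double)
  then show ?thesis by (simp add: cmod_def)
qed

text \<open>For \<open>|x| \<le> 1\<close> both terms agree with
  \<open>1 + \<i> x - x^2 / 2\<close>, up to \<open>|x|^3 / 6\<close> and
  \<open>5 |x|^3 / 8\<close>. For larger \<open>|x|\<close> both have modulus at most 1, and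
  \<open>2 |x|^3\<close> exceeds the trivial bound 2.\<close>

lemma iexp_quadratic_approx:
  fixes x :: real
  shows "cmod (iexp x - (1 + \<i> * x) * exp (- x\<^sup>2 / 2)) \<le> 2 * \<bar>x\<bar> ^ 3"
proof (cases "\<bar>x\<bar> \<le> 1")
  case False
  have "cmod (1 + \<i> * x) * exp (- x\<^sup>2 / 2) \<le> exp (x\<^sup>2 / 2) * exp (- x\<^sup>2 / 2)"
    by (intro mult_right_mono cmod_one_plus_ii_le) auto
  then have "cmod ((1 + \<i> * x) * exp (- x\<^sup>2 / 2)) \<le> 1"
    by (simp add: norm_mult flip: exp_add)
  then have "cmod (iexp x - (1 + \<i> * x) * exp (- x\<^sup>2 / 2)) \<le> 1 + 1"
    by (intro order_trans[OF norm_triangle_ineq4] add_mono) auto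
  also have "\<dots> \<le> 2 * \<bar>x\<bar> ^ 3" using False by (simp add: one_le_power)
  finally show ?thesis .
next
  case True
  define y where "y = x\<^sup>2 / 2"
  have y0: "y \<ge> 0" by (simp add: y_def)
  have e1: "\<bar>exp (- y) - (1 - y)\<bar> \<le> y\<^sup>2 / 2"
  proof -
    have "1 - y \<le> exp (-y)" using exp_ge_add_one_self[of "-y"] by simp
    moreover have "exp (-y) \<le> 1 - y + y\<^sup>2 / 2"
    proof (cases "y = 0")
      case False
      then obtain s where "exp (-y) = (\<Sum>m<2. (-y) ^ m / fact m) + exp s / fact 2 * (-y)\<^sup>2" "\<bar>s\<bar> \<le> \<bar>y\<bar>" "s \<le> 0"
      proof -
        have "\<exists>s. -y < s \<and> s < 0 \<and> exp (-y) = (\<Sum>m<2. exp 0 / fact m * (-y - 0) ^ m) + exp s / fact 2 * (-y - 0)\<^sup>2"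
          using Taylor[of 2 "\<lambda>_. exp" exp "-y" 0 0 "-y"] y0 False by (auto intro!: derivative_eq_intros)
        then show ?thesis using that by (auto simp: abs_if)
      qed
      then have "exp (-y) = 1 - y + exp s * y\<^sup>2 / 2" by (simp add: numeral_2_eq_2)
      also have "\<dots> \<le> 1 - y + 1 * y\<^sup>2 / 2" using \<open>s \<le> 0\<close>
        by (intro add_left_mono divide_right_mono mult_right_mono) auto
      finally show ?thesis by simp
    qed simp
    ultimately show ?thesis by simp
  qed
  have e2: "\<bar>exp (- y) - 1\<bar> \<le> y" using exp_ge_add_one_self[of "-y"] y0 by simp
  have a1: "cmod (iexp x - (1 + \<i> * x - y)) \<le> \<bar>x\<bar> ^ 3 / 6"
    using iexp_approx1[of x 2] by (simp add: numeral_2_eq_2 y_def numeral_3_eq_3 power_mult_distrib)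
  have "(1 + \<i> * x) * exp (- y) - (1 + \<i> * x - y) =
      of_real (exp (- y) - (1 - y)) + \<i> * of_real (x * (exp (-y) - 1))"
    by (simp add: algebra_simps)
  also have "cmod \<dots> \<le> \<bar>exp (- y) - (1 - y)\<bar> + \<bar>x\<bar> * \<bar>exp (-y) - 1\<bar>"
    by (intro order_trans[OF norm_triangle_ineq] add_mono) (auto simp: norm_mult abs_mult simp del: of_real_diff of_real_mult)
  also have "\<dots> \<le> y\<^sup>2 / 2 + \<bar>x\<bar> * y" using e1 e2 by (intro add_mono mult_left_mono) auto
  also have "\<dots> = \<bar>x\<bar>^3 * \<bar>x\<bar> / 8 + \<bar>x\<bar>^3 / 2"
    by (simp add: y_def power2_eq_square numeral_3_eq_3 abs_mult_self_eq)
  also have "\<dots> \<le> \<bar>x\<bar>^3 * 1 / 8 + \<bar>x\<bar>^3 / 2"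
    using True by (intro add_mono divide_right_mono mult_left_mono) auto
  finally have a2: "cmod ((1 + \<i> * x) * exp (- y) - (1 + \<i> * x - y)) \<le> \<bar>x\<bar>^3 * 5 / 8" by simp
  have "cmod (iexp x - (1 + \<i> * x) * exp (- y)) =
     cmod ((iexp x - (1 + \<i> * x - y)) - ((1 + \<i> * x) * exp (- y) - (1 + \<i> * x - y)))" by simp
  also have "\<dots> \<le> \<bar>x\<bar> ^ 3 / 6 + \<bar>x\<bar>^3 * 5 / 8"
    by (intro order_trans[OF norm_triangle_ineq4] add_mono a1 a2)
  also have "\<dots> \<le> 2 * \<bar>x\<bar>^3" by simp
  finally show ?thesis by (simp add: y_def)
qed

text \<open>All factors on both sides lie in the closed unit disc, so the difference of the products
  is at most the sum of the differences of the factors.\<close>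

lemma iexp_sum_prod_approx:
  fixes x :: "'i \<Rightarrow> real"
  assumes "finite I"
  shows "cmod (iexp (\<Sum>j\<in>I. x j) - (\<Prod>j\<in>I. 1 + \<i> * x j) * exp (- (\<Sum>j\<in>I. (x j)\<^sup>2) / 2))
           \<le> (\<Sum>j\<in>I. 2 * \<bar>x j\<bar> ^ 3)"
proof -
  have "iexp (\<Sum>j\<in>I. x j) = (\<Prod>j\<in>I. iexp (x j))"
    using assms by (simp add: exp_sum sum_distrib_left)
  moreover have "(\<Prod>j\<in>I. 1 + \<i> * x j) * of_real (exp (- (\<Sum>j\<in>I. (x j)\<^sup>2) / 2)) =
      (\<Prod>j\<in>I. (1 + \<i> * x j) * of_real (exp (- (x j)\<^sup>2 / 2)))"
    using assms by (simp add: prod.distrib exp_sum sum_divide_distrib flip: sum_negf of_real_prod)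
  moreover have "cmod ((1 + \<i> * x j) * of_real (exp (- (x j)\<^sup>2 / 2))) \<le> 1" for j
  proof -
    have "cmod (1 + \<i> * x j) * exp (- (x j)\<^sup>2 / 2) \<le> exp ((x j)\<^sup>2 / 2) * exp (- (x j)\<^sup>2 / 2)"
      by (intro mult_right_mono cmod_one_plus_ii_le) auto
    then show ?thesis by (simp add: norm_mult flip: exp_add)
  qed
  ultimately have "cmod (iexp (\<Sum>j\<in>I. x j) - (\<Prod>j\<in>I. 1 + \<i> * x j) * exp (- (\<Sum>j\<in>I. (x j)\<^sup>2) / 2))
      \<le> (\<Sum>j\<in>I. cmod (iexp (x j) - (1 + \<i> * x j) * of_real (exp (- (x j)\<^sup>2 / 2))))"
    by (simp only:) (rule norm_prod_diff, auto)
  also have "\<dots> \<le> (\<Sum>j\<in>I. 2 * \<bar>x j\<bar> ^ 3)"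
    by (intro sum_mono iexp_quadratic_approx)
  finally show ?thesis .
qed

lemma cmod_prod_one_plus_ii_le:
  fixes x :: "'i \<Rightarrow> real"
  shows "cmod (\<Prod>j\<in>I. 1 + \<i> * x j) \<le> exp ((\<Sum>j\<in>I. (x j)\<^sup>2) / 2)"
proof (cases "finite I")
  case True
  have "cmod (\<Prod>j\<in>I. 1 + \<i> * x j) \<le> (\<Prod>j\<in>I. exp ((x j)\<^sup>2 / 2))"
    unfolding prod_norm[symmetric] by (intro prod_mono) (use cmod_one_plus_ii_le in auto)
  with True show ?thesis by (simp add: exp_sum sum_divide_distrib)
qed simp

text \<open>The partial product \<open>T k\<close> is bounded and \<open>F k\<close>-measurable, so
  \<open>T k * D k\<close> has expectation 0 and the next factor leaves the expectation unchanged.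
  Orthogonality is assumed for real test functions, hence the split into real and imaginary
  parts.\<close>

lemma (in prob_space) martingale_difference_product_expectation:
  fixes D :: "nat \<Rightarrow> 'a \<Rightarrow> real" and t :: real
  assumes sub: "\<And>k. k \<le> n \<Longrightarrow> subalgebra M (F k)"
    and mono: "\<And>k. k < n \<Longrightarrow> subalgebra (F (Suc k)) (F k)"
    and D: "\<And>k. k < n \<Longrightarrow> D k \<in> bdd_meas (F (Suc k))"
    and orth: "\<And>k g. k < n \<Longrightarrow> g \<in> bdd_meas (F k) \<Longrightarrow> expectation (\<lambda>x. g x * D k x) = 0"
  shows "integrable M (\<lambda>x. \<Prod>j<n. 1 + \<i> * complex_of_real (t * D j x))"
    and "(CLINT x|M. (\<Prod>j<n. 1 + \<i> * complex_of_real (t * D j x))) = 1"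
proof -
  define T where "T k x = (\<Prod>j<k. 1 + \<i> * complex_of_real (t * D j x))" for k x
  have T: "(\<lambda>x. Re (T k x)) \<in> bdd_meas (F k) \<and> (\<lambda>x. Im (T k x)) \<in> bdd_meas (F k)" if "k \<le> n" for k
    using that
  proof (induction k)
    case 0
    then show ?case by (simp add: T_def)
  next
    case (Suc k)
    then have "(\<lambda>x. Re (T k x)) \<in> bdd_meas (F (Suc k))" "(\<lambda>x. Im (T k x)) \<in> bdd_meas (F (Suc k))"
      "D k \<in> bdd_meas (F (Suc k))"
      using mono[of k] D[of k] by (auto intro: bdd_meas_subalgebra)
    moreover have "Re (T (Suc k) x) = Re (T k x) - t * (Im (T k x) * D k x)"
      "Im (T (Suc k) x) = Im (T k x) + t * (Re (T k x) * D k x)" for x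
      by (auto simp: T_def algebra_simps)
    ultimately show ?case by (auto intro!: bdd_meas_diff bdd_meas_add bdd_meas_mult)
  qed
  have TM: "(\<lambda>x. Re (T k x)) \<in> bdd_meas M" "(\<lambda>x. Im (T k x)) \<in> bdd_meas M" if "k \<le> n" for k
    using T[OF that] bdd_meas_subalgebra[OF sub[OF that]] by auto
  have DM: "D k \<in> bdd_meas M" if "k < n" for k
    using D[OF that] bdd_meas_subalgebra[OF sub[of "Suc k"]] that by auto
  have int: "integrable M (T k)" if "k \<le> n" for k
  proof -
    have "integrable M (\<lambda>x. complex_of_real (Re (T k x)) + \<i> * complex_of_real (Im (T k x)))"
      using TM[OF that] by (intro Bochner_Integration.integrable_add integrable_mult_right integrable_of_real) auto
    then show ?thesis by (simp flip: complex_eq)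
  qed
  have "(CLINT x|M. T k x) = 1" if "k \<le> n" for k
    using that
  proof (induction k)
    case 0
    then show ?case by (simp add: T_def prob_space)
  next
    case (Suc k)
    have k: "k < n" "k \<le> n" "Suc k \<le> n" using Suc.prems by auto
    have IH: "(CLINT x|M. T k x) = 1" using Suc by simp
    have reT: "expectation (\<lambda>x. Re (T k x)) = 1" and imT: "expectation (\<lambda>x. Im (T k x)) = 0"
      using integral_Re[OF int[OF k(2)]] integral_Im[OF int[OF k(2)]] IH by simp_all
    have ints: "integrable M (\<lambda>x. Re (T k x))" "integrable M (\<lambda>x. Im (T k x))"
      "integrable M (\<lambda>x. Re (T k x) * D k x)" "integrable M (\<lambda>x. Im (T k x) * D k x)"
      using TM[OF k(2)] DM[OF k(1)] by auto
    have o: "expectation (\<lambda>x. Re (T k x) * D k x) = 0" "expectation (\<lambda>x. Im (T k x) * D k x) = 0"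
      using orth[OF k(1)] T[OF k(2)] by auto
    have rw: "Re (T (Suc k) x) = Re (T k x) - t * (Im (T k x) * D k x)"
      "Im (T (Suc k) x) = Im (T k x) + t * (Re (T k x) * D k x)" for x
      by (auto simp: T_def algebra_simps)
    have "Re (CLINT x|M. T (Suc k) x) = 1" "Im (CLINT x|M. T (Suc k) x) = 0"
      using integral_Re[OF int[OF k(3)]] integral_Im[OF int[OF k(3)]] ints o reT imT
      by (simp_all add: rw)
    then show ?case by (simp add: complex_eq_iff)
  qed
  from this[of n] int[of n] show "integrable M (\<lambda>x. \<Prod>j<n. 1 + \<i> * complex_of_real (t * D j x))"
    "(CLINT x|M. (\<Prod>j<n. 1 + \<i> * complex_of_real (t * D j x))) = 1"
    by (simp_all add: T_def[abs_def])
qed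

lemma abs_exp_minus_diff_le:
  fixes a b :: real
  assumes "a \<ge> 0" "b \<ge> 0"
  shows "\<bar>exp (- a) - exp (- b)\<bar> \<le> \<bar>a - b\<bar>"
proof -
  have *: "\<bar>exp (- a) - exp (- b)\<bar> \<le> \<bar>a - b\<bar>" if "a \<ge> 0" "a \<le> b" for a b :: real
  proof -
    have "exp (- b) = exp (- a) * exp (- (b - a))" by (simp flip: exp_add)
    moreover have "1 - (b - a) \<le> exp (- (b - a))" by (rule order_trans[OF _ exp_ge_add_one_self]) simp
    ultimately have "exp (- a) - exp (- b) \<le> exp (- a) * (b - a)"
      using mult_left_mono[of "1 - (b - a)" "exp (- (b - a))" "exp (- a)"] by (simp add: right_diff_distrib)
    also have "\<dots> \<le> 1 * (b - a)" using that by (intro mult_right_mono) auto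
    finally show ?thesis using that by simp
  qed
  show ?thesis using *[of a b] *[of b a] assms by (cases "a \<le> b") (auto simp: abs_minus_commute)
qed

text \<open>
  McLeish's argument: after stopping at the first time the quadratic variation exceeds \<open>2\<close>, the
  product \<open>T = \<Prod>j. 1 + \<i> t D\<^sub>j\<close> is bounded and has expectation \<open>1\<close>, and
  \<open>exp (\<i> t \<Sum>j. D\<^sub>j)\<close> is close to \<open>T exp (- t\<^sup>2 / 2 \<Sum>j. D\<^sub>j\<^sup>2)\<close>.
\<close>

lemma (in prob_space) martingale_difference_char_bound:
  fixes D :: "nat \<Rightarrow> 'a \<Rightarrow> real" and t B :: real
  assumes sub: "\<And>k. k \<le> n \<Longrightarrow> subalgebra M (F k)"
    and mono: "\<And>k. k < n \<Longrightarrow> subalgebra (F (Suc k)) (F k)"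
    and D: "\<And>k. k < n \<Longrightarrow> D k \<in> bdd_meas (F (Suc k))"
    and bound: "\<And>k x. k < n \<Longrightarrow> \<bar>D k x\<bar> \<le> B" and B: "0 \<le> B" "B \<le> 1"
    and orth: "\<And>k g. k < n \<Longrightarrow> g \<in> bdd_meas (F k) \<Longrightarrow> expectation (\<lambda>x. g x * D k x) = 0"
  shows "cmod ((CLINT x|M. iexp (t * (\<Sum>j<n. D j x))) - exp (- t\<^sup>2 / 2)) \<le>
    6 * \<bar>t\<bar> ^ 3 * B + (2 + t\<^sup>2 * exp (3 * t\<^sup>2 / 2)) * expectation (\<lambda>x. \<bar>(\<Sum>j<n. (D j x)\<^sup>2) - 1\<bar>)"
proof -
  \<comment> \<open>The sum runs over \<open>i < j\<close>, so stopping is decided before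
    \<open>D j\<close> is seen: \<open>ind j\<close> is \<open>F j\<close>-measurable and
    \<open>D'\<close> stays orthogonal to the past. The square that crosses the level 2 is still
    included; it is at most 1 as \<open>B \<le> 1\<close>, which gives
    \<open>Q' x \<le> 3\<close>.\<close>
  define ind where "ind j x = (if (\<Sum>i<j. (D i x)\<^sup>2) \<le> 2 then 1 else (0::real))" for j x
  define D' where "D' j x = ind j x * D j x" for j x
  have up: "subalgebra (F l) (F k)" if "k \<le> l" "l \<le> n" for k l
    using that
  proof (induction l)
    case 0 then show ?case by (auto simp: subalgebra_def)
  next
    case (Suc l)
    then show ?case using mono[of l] by (cases "k = Suc l") (auto simp: subalgebra_def)
  qed
  have DF: "D j \<in> bdd_meas (F k)" if "j < k" "k \<le> n" for j k
    using D[of j] up[of "Suc j" k] that by (auto intro: bdd_meas_subalgebra)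
  have indF: "ind j \<in> bdd_meas (F j)" if "j < n" for j
  proof (rule bdd_measI[where K = 1])
    have [measurable]: "(\<lambda>x. \<Sum>i<j. (D i x)\<^sup>2) \<in> borel_measurable (F j)"
      using that by (intro bdd_meas_measurable bdd_meas_sum bdd_meas_power2 DF) auto
    show "ind j \<in> borel_measurable (F j)" unfolding ind_def[abs_def] by measurable
  qed (simp add: ind_def)
  have D'F: "D' k \<in> bdd_meas (F (Suc k))" if "k < n" for k
    using bdd_meas_mult[OF bdd_meas_subalgebra[OF mono[OF that] indF[OF that]] D[OF that]]
    by (simp add: D'_def[abs_def])
  have orth': "expectation (\<lambda>x. g x * D' k x) = 0" if "k < n" "g \<in> bdd_meas (F k)" for k g
    using orth[OF that(1) bdd_meas_mult[OF that(2) indF[OF that(1)]]] by (simp add: D'_def mult_ac)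
  define Q where "Q x = (\<Sum>j<n. (D j x)\<^sup>2)" for x
  define Q' where "Q' x = (\<Sum>j<n. (D' j x)\<^sup>2)" for x
  define T where "T x = (\<Prod>j<n. 1 + \<i> * complex_of_real (t * D' j x))" for x
  have T: "integrable M T" "(CLINT x|M. T x) = 1"
    unfolding T_def[abs_def] 
    by (rule martingale_difference_product_expectation[where F = F]; fact sub mono D'F orth')+
  have D'_le: "(D' j x)\<^sup>2 \<le> (D j x)\<^sup>2" for j x by (simp add: D'_def ind_def)
  have Q'3: "Q' x \<le> 3" for x
  proof -
    have "(\<Sum>j<k. (D' j x)\<^sup>2) \<le> 3" if "k \<le> n" for k
      using that
    proof (induction k)
      case (Suc k)
      show ?case
      proof (cases "(\<Sum>i<k. (D i x)\<^sup>2) \<le> 2")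
        case True
        have "(D' k x)\<^sup>2 \<le> (D k x)\<^sup>2" by (rule D'_le)
        also have "\<dots> \<le> 1" using bound[of k x] B Suc.prems by (simp add: abs_square_le_1)
        finally have "(D' k x)\<^sup>2 \<le> 1" .
        moreover have "(\<Sum>j<k. (D' j x)\<^sup>2) \<le> (\<Sum>i<k. (D i x)\<^sup>2)" by (intro sum_mono D'_le)
        ultimately show ?thesis using True by simp
      next
        case False
        then show ?thesis using Suc by (simp add: D'_def ind_def)
      qed
    qed simp
    then show ?thesis by (simp add: Q'_def)
  qed
  have Q'0: "Q' x \<ge> 0" and Q0: "Q x \<ge> 0" for x by (simp_all add: Q'_def Q_def sum_nonneg)
  have same: "D' j x = D j x" if "Q x \<le> 2" "j < n" for j x
  proof -
    have "(\<Sum>i<j. (D i x)\<^sup>2) \<le> Q x" unfolding Q_def using that by (intro sum_mono2) auto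
    then show ?thesis using that by (simp add: D'_def ind_def)
  qed
  \<comment> \<open>Stopping acts only where \<open>Q x > 2\<close>. There
    \<open>|Q x - 1| > 1\<close> pays for any error of size 2: that of \<open>Q' x - 1\<close>, as
    \<open>0 \<le> Q' x \<le> 3\<close>, and below that of two exponentials of modulus 1.\<close>
  have Qd: "\<bar>Q' x - 1\<bar> \<le> 2 * \<bar>Q x - 1\<bar>" for x
  proof (cases "Q x \<le> 2")
    case True
    then have "Q' x = Q x" by (simp add: Q_def Q'_def same)
    then show ?thesis by simp
  next
    case False
    then show ?thesis using Q'0[of x] Q'3[of x] by (simp add: abs_if)
  qed
  have b1: "cmod (iexp (t * (\<Sum>j<n. D j x)) - iexp (t * (\<Sum>j<n. D' j x))) \<le> 2 * \<bar>Q x - 1\<bar>" for x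
  proof (cases "Q x \<le> 2")
    case True
    then show ?thesis by (simp add: same)
  next
    case False
    have "cmod (iexp (t * (\<Sum>j<n. D j x)) - iexp (t * (\<Sum>j<n. D' j x))) \<le> 1 + 1"
      by (intro order_trans[OF norm_triangle_ineq4] add_mono) auto
    then show ?thesis using False by simp
  qed
  have b2: "cmod (iexp (t * (\<Sum>j<n. D' j x)) - T x * exp (- t\<^sup>2 * Q' x / 2)) \<le> 6 * \<bar>t\<bar> ^ 3 * B" for x
  proof -
    have "cmod (iexp (t * (\<Sum>j<n. D' j x)) - T x * exp (- t\<^sup>2 * Q' x / 2)) \<le> (\<Sum>j<n. 2 * \<bar>t * D' j x\<bar> ^ 3)"
    proof -
      have "- t\<^sup>2 * Q' x = - (\<Sum>j<n. (t * D' j x)\<^sup>2)"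
        by (simp add: Q'_def sum_distrib_left power_mult_distrib sum_negf)
      then show ?thesis
        using iexp_sum_prod_approx[of "{..<n}" "\<lambda>j. t * D' j x"]
        by (simp only: T_def sum_distrib_left) simp
    qed
    also have "\<dots> \<le> (\<Sum>j<n. 2 * \<bar>t\<bar>^3 * B * (D' j x)\<^sup>2)"
    proof (rule sum_mono)
      fix j assume "j \<in> {..<n}"
      then have "\<bar>D' j x\<bar> \<le> B" using bound[of j x] B by (auto simp: D'_def ind_def)
      then have "\<bar>D' j x\<bar> * (D' j x)\<^sup>2 \<le> B * (D' j x)\<^sup>2" by (intro mult_right_mono) auto
      then have "2 * \<bar>t\<bar>^3 * (\<bar>D' j x\<bar> * (D' j x)\<^sup>2) \<le> 2 * \<bar>t\<bar>^3 * (B * (D' j x)\<^sup>2)"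
        by (intro mult_left_mono) auto
      then show "2 * \<bar>t * D' j x\<bar> ^ 3 \<le> 2 * \<bar>t\<bar>^3 * B * (D' j x)\<^sup>2"
        by (simp add: abs_mult power_mult_distrib power2_eq_square numeral_3_eq_3 mult_ac)
    qed
    also have "\<dots> = 2 * \<bar>t\<bar>^3 * B * Q' x" by (simp add: Q'_def sum_distrib_left)
    also have "\<dots> \<le> 2 * \<bar>t\<bar>^3 * B * 3" using B Q'3 by (intro mult_left_mono) auto
    finally show ?thesis by simp
  qed
  have b3: "cmod (T x * exp (- t\<^sup>2 * Q' x / 2) - T x * exp (- t\<^sup>2 / 2)) \<le> exp (3 * t\<^sup>2 / 2) * (t\<^sup>2 * \<bar>Q x - 1\<bar>)" for x
  proof -
    have "cmod (T x) \<le> exp ((\<Sum>j<n. (t * D' j x)\<^sup>2) / 2)"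
      unfolding T_def by (rule cmod_prod_one_plus_ii_le)
    also have "(\<Sum>j<n. (t * D' j x)\<^sup>2) = t\<^sup>2 * Q' x" by (simp add: Q'_def sum_distrib_left power_mult_distrib sum_negf)
    also have "exp (t\<^sup>2 * Q' x / 2) \<le> exp (3 * t\<^sup>2 / 2)"
      using mult_left_mono[OF Q'3[of x], of "t\<^sup>2"] by simp
    finally have T_le: "cmod (T x) \<le> exp (3 * t\<^sup>2 / 2)" .
    have "\<bar>exp (- (t\<^sup>2 * Q' x / 2)) - exp (- (t\<^sup>2 / 2))\<bar> \<le> \<bar>t\<^sup>2 * Q' x / 2 - t\<^sup>2 / 2\<bar>"
      by (intro abs_exp_minus_diff_le) (auto simp: Q'0)
    also have "\<dots> = t\<^sup>2 / 2 * \<bar>Q' x - 1\<bar>"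
    proof -
      have "t\<^sup>2 * Q' x / 2 - t\<^sup>2 / 2 = t\<^sup>2 / 2 * (Q' x - 1)" by (simp add: field_simps)
      then show ?thesis by (simp only: abs_mult) simp
    qed
    also have "\<dots> \<le> t\<^sup>2 / 2 * (2 * \<bar>Q x - 1\<bar>)" by (intro mult_left_mono Qd) auto
    finally have "\<bar>exp (- (t\<^sup>2 * Q' x / 2)) - exp (- (t\<^sup>2 / 2))\<bar> \<le> t\<^sup>2 * \<bar>Q x - 1\<bar>" by simp
    moreover have "cmod (T x * exp (- t\<^sup>2 * Q' x / 2) - T x * exp (- t\<^sup>2 / 2)) =
        cmod (T x) * \<bar>exp (- (t\<^sup>2 * Q' x / 2)) - exp (- (t\<^sup>2 / 2))\<bar>"
      by (simp flip: right_diff_distrib of_real_diff add: norm_mult)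
    ultimately show ?thesis using T_le by (simp add: mult_mono)
  qed
  have b: "cmod (iexp (t * (\<Sum>j<n. D j x)) - T x * exp (- t\<^sup>2 / 2)) \<le>
     6 * \<bar>t\<bar> ^ 3 * B + (2 + t\<^sup>2 * exp (3 * t\<^sup>2 / 2)) * \<bar>Q x - 1\<bar>" for x
  proof -
    have "cmod (iexp (t * (\<Sum>j<n. D j x)) - T x * exp (- t\<^sup>2 / 2)) \<le>
      cmod (iexp (t * (\<Sum>j<n. D j x)) - iexp (t * (\<Sum>j<n. D' j x))) +
      (cmod (iexp (t * (\<Sum>j<n. D' j x)) - T x * exp (- t\<^sup>2 * Q' x / 2)) +
      cmod (T x * exp (- t\<^sup>2 * Q' x / 2) - T x * exp (- t\<^sup>2 / 2)))"
      (is "cmod (?a - ?d) \<le> cmod (?a - ?b) + (cmod (?b - ?c) + cmod (?c - ?d))")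
      using norm_triangle_ineq[of "?a - ?b" "?b - ?d"] norm_triangle_ineq[of "?b - ?c" "?c - ?d"] by simp
    then show ?thesis using b1[of x] b2[of x] b3[of x] by (simp add: algebra_simps)
  qed
  have [measurable]: "(\<lambda>x. \<Sum>j<n. D j x) \<in> borel_measurable M"
    by (intro bdd_meas_measurable[of _ M] bdd_meas_sum bdd_meas_subalgebra[OF sub[of n]] DF) auto
  have Qint: "integrable M (\<lambda>x. \<bar>Q x - 1\<bar>)"
    unfolding Q_def
    by (intro bdd_meas_integrable bdd_meas_abs bdd_meas_diff bdd_meas_sum bdd_meas_power2
        bdd_meas_subalgebra[OF sub[of n]] DF bdd_meas_const) auto
  have iint: "integrable M (\<lambda>x. iexp (t * (\<Sum>j<n. D j x)))"
  proof (rule integrable_const_bound[where B = 1])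
    show "(\<lambda>x. iexp (t * (\<Sum>j<n. D j x))) \<in> borel_measurable M" by measurable
  qed simp
  have Tint: "integrable M (\<lambda>x. T x * exp (- t\<^sup>2 / 2))"
    by (intro integrable_mult_left T)
  have "(CLINT x|M. iexp (t * (\<Sum>j<n. D j x))) - exp (- t\<^sup>2 / 2) =
     (CLINT x|M. iexp (t * (\<Sum>j<n. D j x)) - T x * exp (- t\<^sup>2 / 2))"
    using T(2) by (subst Bochner_Integration.integral_diff[OF iint Tint]) simp
  also have "cmod \<dots> \<le> expectation (\<lambda>x. cmod (iexp (t * (\<Sum>j<n. D j x)) - T x * exp (- t\<^sup>2 / 2)))"
    by (rule integral_norm_bound)
  also have "\<dots> \<le> expectation (\<lambda>x. 6 * \<bar>t\<bar> ^ 3 * B + (2 + t\<^sup>2 * exp (3 * t\<^sup>2 / 2)) * \<bar>Q x - 1\<bar>)"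
    using iint Tint Qint b by (intro integral_mono) auto
  also have "\<dots> = 6 * \<bar>t\<bar> ^ 3 * B + (2 + t\<^sup>2 * exp (3 * t\<^sup>2 / 2)) * expectation (\<lambda>x. \<bar>Q x - 1\<bar>)"
    using Qint by (simp add: prob_space)
  finally show ?thesis by (simp add: Q_def)
qed

text \<open>Telescoping with a delayed start; \<open>u\<close> will be \<open>i - Suc m\<close>, the
  time from which \<open>X i\<close> counts in the truncated differences.\<close>

lemma sum_from_Suc_diff:
  fixes f :: "nat \<Rightarrow> real"
  assumes "a \<le> b"
  shows "(\<Sum>j=a..<b. if u \<le> j then f (Suc j) - f j else 0) =
    (if max a u \<le> b then f b - f (max a u) else 0)"
proof -
  have "(\<Sum>j=a..<b. if u \<le> j then f (Suc j) - f j else 0) = (\<Sum>j=max a u..<b. f (Suc j) - f j)"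
    by (rule sum.mono_neutral_cong_right) auto
  then show ?thesis using sum_Suc_diff'[of "max a u" b f] by (cases "max a u \<le> b") auto
qed

subsection \<open>Truncated martingale approximation\<close>

text \<open>
  \<open>F k\<close> stands for the past up to time \<open>k\<close> and \<open>G k\<close> for the present; \<open>G 0\<close> is trivial, so that
  time \<open>0\<close> needs no special treatment.
\<close>

locale rho_mixing_chain = prob_space M for M :: "'a measure" +
  fixes F G :: "nat \<Rightarrow> 'a measure" and n :: nat and r :: real
  assumes sub_F: "k \<le> n \<Longrightarrow> subalgebra M (F k)"
    and mono_F: "k < n \<Longrightarrow> subalgebra (F (Suc k)) (F k)"
    and sub_G: "k \<le> n \<Longrightarrow> subalgebra (F k) (G k)"
    and trivial_0: "h \<in> bdd_meas (G 0) \<Longrightarrow> expectation h = 0 \<Longrightarrow> expectation (\<lambda>x. (h x)\<^sup>2) = 0"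
    and markov_step: "k < n \<Longrightarrow> h \<in> bdd_meas (G (Suc k)) \<Longrightarrow> (\<And>x. \<bar>h x\<bar> \<le> K) \<Longrightarrow>
      \<exists>h'\<in>bdd_meas (G k). (\<forall>x. \<bar>h' x\<bar> \<le> K) \<and>
        (\<forall>g\<in>bdd_meas (F k). expectation (\<lambda>x. g x * h x) = expectation (\<lambda>x. g x * h' x))"
    and contraction: "k < n \<Longrightarrow> g \<in> bdd_meas (G k) \<Longrightarrow> h \<in> bdd_meas (G (Suc k)) \<Longrightarrow>
      expectation g = 0 \<Longrightarrow> expectation h = 0 \<Longrightarrow>
      expectation (\<lambda>x. g x * h x) \<le>
        r * sqrt (expectation (\<lambda>x. (g x)\<^sup>2)) * sqrt (expectation (\<lambda>x. (h x)\<^sup>2))"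
    and r: "0 \<le> r" "r < 1"
begin

abbreviation l2 :: "('a \<Rightarrow> real) \<Rightarrow> real" where
  "l2 f \<equiv> sqrt (expectation (\<lambda>x. (f x)\<^sup>2))"

lemma F_up: "k \<le> l \<Longrightarrow> l \<le> n \<Longrightarrow> g \<in> bdd_meas (F k) \<Longrightarrow> g \<in> bdd_meas (F l)"
  by (induction l rule: dec_induct) (auto intro: bdd_meas_subalgebra[OF mono_F])

lemma F_M: "g \<in> bdd_meas (F k) \<Longrightarrow> k \<le> n \<Longrightarrow> g \<in> bdd_meas M"
  by (rule bdd_meas_subalgebra[OF sub_F])

lemma G_F: "k \<le> n \<Longrightarrow> g \<in> bdd_meas (G k) \<Longrightarrow> g \<in> bdd_meas (F k)"
  by (rule bdd_meas_subalgebra[OF sub_G])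

lemma G_M: "g \<in> bdd_meas (G k) \<Longrightarrow> k \<le> n \<Longrightarrow> g \<in> bdd_meas M"
  using F_M[OF G_F] by blast

section \<open>Geometric decay under projection\<close>

text \<open>Testing the projection identity with \<open>h'\<close> itself bounds
  \<open>(l2 h')^2\<close> by \<open>r * l2 h' * l2 h\<close>, and one factor cancels. This turns
  the correlation bound for pairs into a contraction of norms.\<close>

lemma projection_contracts:
  assumes k: "k < n" and h: "h \<in> bdd_meas (G (Suc k))" and h': "h' \<in> bdd_meas (G k)"
    and "expectation h = 0"
    and proj: "\<And>g. g \<in> bdd_meas (F k) \<Longrightarrow> expectation (\<lambda>x. g x * h x) = expectation (\<lambda>x. g x * h' x)"
  shows "l2 h' \<le> r * l2 h"
proof -
  have "expectation h' = 0" using proj[of "\<lambda>_. 1"] assms by simp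
  then have "expectation (\<lambda>x. h' x * h x) \<le> r * l2 h' * l2 h"
    using contraction[OF k h' h] assms by simp
  then have "expectation (\<lambda>x. h' x * h' x) \<le> r * l2 h' * l2 h"
    using proj[of h'] G_F[of k h'] h' k by simp
  then have "l2 h' * l2 h' \<le> l2 h' * (r * l2 h)"
    by (simp add: power2_eq_square mult_ac)
  moreover have "0 \<le> l2 h'" "0 \<le> r * l2 h" using r by simp_all
  ultimately show ?thesis
    by (cases "l2 h' = 0") (simp_all only: mult_le_cancel_left_pos order.not_eq_order_implies_strict[of 0 "l2 h'"])
qed

text \<open>Each step back from \<open>k\<close> to \<open>l\<close> replaces \<open>h\<close> by
  its projection, which leaves expectations against functions of the past unchanged and gains a
  factor \<open>r\<close>. That \<open>g\<close> may depend on the whole past up to \<open>l\<close>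
  is the contribution of the Markov property.\<close>

lemma mixing:
  assumes "l \<le> k" "k \<le> n" and h: "h \<in> bdd_meas (G k)" "expectation h = 0"
    and g: "g \<in> bdd_meas (F l)" and A: "\<And>x. \<bar>g x\<bar> \<le> A"
  shows "\<bar>expectation (\<lambda>x. g x * h x)\<bar> \<le> A * r ^ (k - l) * l2 h"
  using assms(1,2) h
proof (induction k arbitrary: h rule: dec_induct)
  case base
  have gM: "g \<in> bdd_meas M" and hM: "h \<in> bdd_meas M" using F_M[OF g] G_M[of h l] base by auto
  have A0: "0 \<le> A" using A[of undefined] by linarith
  have "\<bar>expectation (\<lambda>x. g x * h x)\<bar> \<le> expectation (\<lambda>x. \<bar>g x * h x\<bar>)"
    by (rule integral_abs_bound)
  also have "\<dots> \<le> expectation (\<lambda>x. A * \<bar>h x\<bar>)"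
    using gM hM A by (intro integral_mono bdd_meas_integrable) (auto simp: abs_mult intro!: mult_right_mono)
  also have "\<dots> \<le> A * l2 h"
    using A0 expectation_abs_le_sqrt[OF hM] by (simp add: mult_left_mono)
  finally show ?case by simp
next
  case (step k)
  have k: "k < n" using step by simp
  obtain K where K: "\<And>x. \<bar>h x\<bar> \<le> K" using step by (auto simp: bdd_meas_def)
  obtain h' where h': "h' \<in> bdd_meas (G k)"
    and proj: "\<And>g. g \<in> bdd_meas (F k) \<Longrightarrow> expectation (\<lambda>x. g x * h x) = expectation (\<lambda>x. g x * h' x)"
    using markov_step[OF k step.prems(2) K] by auto
  have "expectation h' = 0" using proj[of "\<lambda>_. 1"] step by simp
  then have "\<bar>expectation (\<lambda>x. g x * h' x)\<bar> \<le> A * r ^ (k - l) * l2 h'"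
    using step.IH h' k by simp
  also have "\<dots> \<le> A * r ^ (k - l) * (r * l2 h)"
    using A[of undefined] r projection_contracts[OF k _ h' _ proj] step
    by (intro mult_left_mono) auto
  also have "\<dots> = A * r ^ (Suc k - l) * l2 h" using step by (simp add: Suc_diff_le)
  finally show ?case using proj[OF F_up[OF _ _ g]] step by simp
qed

end

text \<open>The bound by \<open>C\<close> holds at every point; for variables bounded only almost
  surely it is arranged by clipping.\<close>

locale rho_mixing_sum = rho_mixing_chain M F G n r
  for M :: "'a measure" and F G n r +
  fixes X :: "nat \<Rightarrow> 'a \<Rightarrow> real" and C :: real
  assumes X_G: "i \<in> {1..n} \<Longrightarrow> X i \<in> bdd_meas (G i)"
    and X_bound: "i \<in> {1..n} \<Longrightarrow> \<bar>X i x\<bar> \<le> C"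
    and X_mean: "i \<in> {1..n} \<Longrightarrow> expectation (X i) = 0"
    and C_nonneg: "0 \<le> C"
begin

section \<open>Iterated projections of one summand\<close>

text \<open>A fixed version of the conditional expectation given the past, chosen to depend on the
  present only and to inherit the bound \<open>C\<close>.\<close>

definition project :: "nat \<Rightarrow> ('a \<Rightarrow> real) \<Rightarrow> 'a \<Rightarrow> real" where
  "project k h = (SOME h'. h' \<in> bdd_meas (G k) \<and> (\<forall>x. \<bar>h' x\<bar> \<le> C) \<and>
     (\<forall>g\<in>bdd_meas (F k). expectation (\<lambda>x. g x * h x) = expectation (\<lambda>x. g x * h' x)))"

lemma project:
  assumes "k < n" "h \<in> bdd_meas (G (Suc k))" "\<And>x. \<bar>h x\<bar> \<le> C"
  shows "project k h \<in> bdd_meas (G k)" "\<bar>project k h x\<bar> \<le> C"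
    "g \<in> bdd_meas (F k) \<Longrightarrow> expectation (\<lambda>x. g x * h x) = expectation (\<lambda>x. g x * project k h x)"
proof -
  have "\<exists>h'. h' \<in> bdd_meas (G k) \<and> (\<forall>x. \<bar>h' x\<bar> \<le> C) \<and>
     (\<forall>g\<in>bdd_meas (F k). expectation (\<lambda>x. g x * h x) = expectation (\<lambda>x. g x * h' x))"
    using markov_step[of k h C] assms by blast
  from someI_ex[OF this]
  show "project k h \<in> bdd_meas (G k)" "\<bar>project k h x\<bar> \<le> C"
    "g \<in> bdd_meas (F k) \<Longrightarrow> expectation (\<lambda>x. g x * h x) = expectation (\<lambda>x. g x * project k h x)"
    unfolding project_def[symmetric] by auto
qed

primrec predict :: "nat \<Rightarrow> nat \<Rightarrow> 'a \<Rightarrow> real" where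
  "predict i 0 = X i"
| "predict i (Suc d) = project (i - Suc d) (predict i d)"

text \<open>
  \<open>cexp k i\<close> is a bounded version of the conditional expectation of \<open>X i\<close> given \<open>F k\<close>, obtained by
  projecting one step at a time.
\<close>

definition cexp :: "nat \<Rightarrow> nat \<Rightarrow> 'a \<Rightarrow> real" where
  "cexp k i = predict i (i - k)"

text \<open>Natural subtraction gives 0 here, so \<open>cexp k i\<close> stays equal to
  \<open>X i\<close> once time \<open>i\<close> has passed, as a conditional expectation given a
  larger past should.\<close>

lemma cexp_self: "i \<le> k \<Longrightarrow> cexp k i = X i"
  by (simp add: cexp_def)

lemma cexp_step:
  assumes "k < i" shows "cexp k i = project k (cexp (Suc k) i)"
proof -
  have "i - k = Suc (i - Suc k)" "i - Suc (i - Suc k) = k" using assms by auto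
  then show ?thesis by (simp add: cexp_def)
qed

lemma cexp_G_bound:
  assumes i: "i \<in> {1..n}" and "k \<le> i"
  shows "cexp k i \<in> bdd_meas (G k) \<and> (\<forall>x. \<bar>cexp k i x\<bar> \<le> C)"
  using assms(2)
proof (induction k rule: inc_induct)
  case base
  then show ?case using X_G X_bound i by (simp add: cexp_self)
next
  case (step k)
  then show ?case using project[of k "cexp (Suc k) i"] i by (simp add: cexp_step)
qed

lemma cexp_G: "i \<in> {1..n} \<Longrightarrow> k \<le> i \<Longrightarrow> cexp k i \<in> bdd_meas (G k)"
  using cexp_G_bound by blast

lemma cexp_bound: "i \<in> {1..n} \<Longrightarrow> \<bar>cexp k i x\<bar> \<le> C"
  using cexp_G_bound[of i k] X_bound by (cases "k \<le> i") (auto simp: cexp_self)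

lemma cexp_M: "i \<in> {1..n} \<Longrightarrow> cexp k i \<in> bdd_meas M"
  using G_M[OF cexp_G, of i k] G_M[OF cexp_G, of i i] by (cases "k \<le> i") (simp_all add: cexp_self)

lemma cexp_orth:
  assumes "i \<in> {1..n}" "k < i" "g \<in> bdd_meas (F k)"
  shows "expectation (\<lambda>x. g x * cexp (Suc k) i x) = expectation (\<lambda>x. g x * cexp k i x)"
  using project(3)[of k "cexp (Suc k) i" g] cexp_G[of i "Suc k"] cexp_bound[of i "Suc k"] assms
  by (simp add: cexp_step)

lemma cexp_mean:
  assumes i: "i \<in> {1..n}" shows "expectation (cexp k i) = 0"
proof (cases "k \<le> i")
  case True
  then show ?thesis
  proof (induction k rule: inc_induct)
    case base
    then show ?case using X_mean i by (simp add: cexp_self)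
  next
    case (step k)
    then show ?case using cexp_orth[OF i, of k "\<lambda>_. 1"] by simp
  qed
next
  case False
  then show ?thesis using X_mean[OF i] by (simp add: cexp_self)
qed

lemma cexp_l2:
  assumes i: "i \<in> {1..n}" and "k \<le> i"
  shows "l2 (cexp k i) \<le> C * r ^ (i - k)"
  using assms(2)
proof (induction k rule: inc_induct)
  case base
  have "expectation (\<lambda>x. (X i x)\<^sup>2) \<le> expectation (\<lambda>x. C\<^sup>2)"
    using cexp_M[OF i, of i] X_bound[OF i] C_nonneg
    by (intro integral_mono bdd_meas_integrable bdd_meas_power2) (auto simp: cexp_self power2_le_iff_abs_le)
  then have "expectation (\<lambda>x. (X i x)\<^sup>2) \<le> C\<^sup>2" by (simp add: prob_space)
  then show ?case using C_nonneg by (simp add: cexp_self real_le_lsqrt)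
next
  case (step k)
  have "l2 (cexp k i) \<le> r * l2 (cexp (Suc k) i)"
    using step i by (intro projection_contracts[of k] cexp_G cexp_mean cexp_orth) auto
  also have "\<dots> \<le> r * (C * r ^ (i - Suc k))" using step r by (intro mult_left_mono) auto
  also have "\<dots> = C * r ^ (i - k)" using step by (simp flip: power_Suc add: Suc_diff_Suc)
  finally show ?case .
qed

text \<open>A centred function of the trivial time 0 vanishes almost surely. This removes the
  remainder terms of the first \<open>m + 1\<close> variables, and all of them when
  \<open>m = n\<close>.\<close>

lemma cexp_0: "i \<in> {1..n} \<Longrightarrow> l2 (cexp 0 i) = 0"
  using trivial_0[of "cexp 0 i"] cexp_G[of i 0] cexp_mean by simp

section \<open>Truncated martingale differences\<close>

text \<open>The sum of \<open>X i\<close> over \<open>j < i \<le> j + 1 + m\<close>, cut at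
  \<open>n\<close>, is predicted at time \<open>j + 1\<close> by \<open>P m j\<close> and at time
  \<open>j\<close> by \<open>Q m j\<close>, so \<open>Q m j\<close> is the projection of
  \<open>P m j\<close>. Thus \<open>D m j\<close> is the difference of the overview at
  \<open>k = j + 1\<close>.\<close>

definition P :: "nat \<Rightarrow> nat \<Rightarrow> 'a \<Rightarrow> real" where
  "P m j x = (\<Sum>i\<in>{Suc j..min n (Suc j + m)}. cexp (Suc j) i x)"

definition Q :: "nat \<Rightarrow> nat \<Rightarrow> 'a \<Rightarrow> real" where
  "Q m j x = (\<Sum>i\<in>{Suc j..min n (Suc j + m)}. cexp j i x)"

definition D :: "nat \<Rightarrow> nat \<Rightarrow> 'a \<Rightarrow> real" where
  "D m j x = P m j x - Q m j x"

lemma P_G: "P m j \<in> bdd_meas (G (Suc j))"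
  unfolding P_def[abs_def] by (intro bdd_meas_sum cexp_G) auto

lemma Q_G: "Q m j \<in> bdd_meas (G j)"
  unfolding Q_def[abs_def] by (intro bdd_meas_sum cexp_G) auto

lemma Q_F: "j \<le> n \<Longrightarrow> Q m j \<in> bdd_meas (F j)"
  using G_F Q_G by blast

lemma P_M: "j < n \<Longrightarrow> P m j \<in> bdd_meas M" and Q_M: "j \<le> n \<Longrightarrow> Q m j \<in> bdd_meas M"
  using G_M[OF P_G] G_M[OF Q_G] by auto

lemma D_F: "j < n \<Longrightarrow> D m j \<in> bdd_meas (F (Suc j))"
  unfolding D_def[abs_def] using G_F[OF _ P_G] F_up[of j "Suc j", OF _ _ Q_F] by auto

lemma D_M: "j < n \<Longrightarrow> D m j \<in> bdd_meas M"
  using F_M[OF D_F] by simp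

lemma P_proj:
  assumes "j < n" and g: "g \<in> bdd_meas (F j)"
  shows "expectation (\<lambda>x. g x * P m j x) = expectation (\<lambda>x. g x * Q m j x)"
proof -
  have gM: "g \<in> bdd_meas M" using F_M[OF assms(2)] assms(1) by simp
  have "expectation (\<lambda>x. g x * P m j x) = (\<Sum>i\<in>{Suc j..min n (Suc j + m)}. expectation (\<lambda>x. g x * cexp (Suc j) i x))"
    unfolding P_def sum_distrib_left using gM
    by (intro Bochner_Integration.integral_sum bdd_meas_integrable bdd_meas_mult cexp_M) auto
  also have "\<dots> = (\<Sum>i\<in>{Suc j..min n (Suc j + m)}. expectation (\<lambda>x. g x * cexp j i x))"
    using g by (intro sum.cong refl cexp_orth) auto
  also have "\<dots> = expectation (\<lambda>x. g x * Q m j x)"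
    unfolding Q_def sum_distrib_left using gM
    by (intro Bochner_Integration.integral_sum[symmetric] bdd_meas_integrable bdd_meas_mult cexp_M) auto
  finally show ?thesis .
qed

lemma P_mean: "expectation (P m j) = 0"
  unfolding P_def[abs_def]
  by (subst Bochner_Integration.integral_sum) (auto intro!: cexp_M simp: cexp_mean)

lemma D_orth:
  assumes "j < n" "g \<in> bdd_meas (F j)"
  shows "expectation (\<lambda>x. g x * D m j x) = 0"
proof -
  have gM: "g \<in> bdd_meas M" using F_M[OF assms(2)] assms(1) by simp
  have "expectation (\<lambda>x. g x * D m j x) = expectation (\<lambda>x. g x * P m j x) - expectation (\<lambda>x. g x * Q m j x)"
    unfolding D_def right_diff_distrib using assms(1) gM
    by (intro Bochner_Integration.integral_diff bdd_meas_integrable bdd_meas_mult P_M Q_M) auto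
  then show ?thesis using P_proj[OF assms] by simp
qed

text \<open>In \<open>D^2 = P^2 + Q^2 - 2 Q P\<close> the test function \<open>g Q\<close> belongs
  to the past, so \<open>P\<close> may be replaced by \<open>Q\<close> in the mixed term. The gain
  is that \<open>P^2\<close> and \<open>Q^2\<close> each depend on the chain at a single time, as
  the mixing estimate requires, whereas \<open>D^2\<close> involves two.\<close>

lemma D_square:
  assumes "j < n" and g: "g \<in> bdd_meas (F j)"
  shows "expectation (\<lambda>x. g x * (D m j x)\<^sup>2) =
    expectation (\<lambda>x. g x * (P m j x)\<^sup>2) - expectation (\<lambda>x. g x * (Q m j x)\<^sup>2)"
proof -
  have gM: "g \<in> bdd_meas M" and PM: "P m j \<in> bdd_meas M" and QM: "Q m j \<in> bdd_meas M"
    using F_M[OF g] P_M Q_M assms(1) by simp_all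
  have "expectation (\<lambda>x. g x * (D m j x)\<^sup>2) =
      expectation (\<lambda>x. g x * (P m j x)\<^sup>2 + g x * (Q m j x)\<^sup>2 - 2 * ((g x * Q m j x) * P m j x))"
    by (intro Bochner_Integration.integral_cong) (auto simp: D_def power2_eq_square algebra_simps)
  also have "\<dots> = expectation (\<lambda>x. g x * (P m j x)\<^sup>2) + expectation (\<lambda>x. g x * (Q m j x)\<^sup>2)
      - 2 * expectation (\<lambda>x. (g x * Q m j x) * P m j x)"
  proof -
    have "integrable M (\<lambda>x. g x * (P m j x)\<^sup>2)" "integrable M (\<lambda>x. g x * (Q m j x)\<^sup>2)"
      "integrable M (\<lambda>x. (g x * Q m j x) * P m j x)"
      by (intro bdd_meas_integrable bdd_meas_mult bdd_meas_power2 gM PM QM)+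
    then show ?thesis by simp
  qed
  also have "expectation (\<lambda>x. (g x * Q m j x) * P m j x) = expectation (\<lambda>x. (g x * Q m j x) * Q m j x)"
    using assms by (intro P_proj bdd_meas_mult Q_F) auto
  finally show ?thesis by (simp add: power2_eq_square mult_ac)
qed

text \<open>Orthogonality survives a weight from the past: \<open>g\<close> times a partial sum is
  an admissible test function for the next difference. The weight will be an earlier squared
  difference.\<close>

lemma D_sum_square:
  assumes "a \<le> b" "b \<le> n" and g: "g \<in> bdd_meas (F a)"
  shows "expectation (\<lambda>x. g x * (\<Sum>j=a..<b. D m j x)\<^sup>2) = (\<Sum>j=a..<b. expectation (\<lambda>x. g x * (D m j x)\<^sup>2))"
  using assms(1,2)
proof (induction b rule: dec_induct)
  case base
  then show ?case by simp
next
  case (step b)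
  have b: "b < n" using step by simp
  have gF: "g \<in> bdd_meas (F b)" using F_up[OF _ _ g] step by simp
  have AF: "(\<lambda>x. \<Sum>j=a..<b. D m j x) \<in> bdd_meas (F b)"
    using step by (intro bdd_meas_sum F_up[OF _ _ D_F]) auto
  have M: "g \<in> bdd_meas M" "(\<lambda>x. \<Sum>j=a..<b. D m j x) \<in> bdd_meas M" "D m b \<in> bdd_meas M"
    using F_M[OF gF] F_M[OF AF] D_M[OF b] b by simp_all
  have "expectation (\<lambda>x. g x * (\<Sum>j=a..<Suc b. D m j x)\<^sup>2) =
    expectation (\<lambda>x. g x * (\<Sum>j=a..<b. D m j x)\<^sup>2 + g x * (D m b x)\<^sup>2 + 2 * ((g x * (\<Sum>j=a..<b. D m j x)) * D m b x))"
    using step(1) by (intro Bochner_Integration.integral_cong) (auto simp: power2_eq_square algebra_simps)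
  also have "\<dots> = expectation (\<lambda>x. g x * (\<Sum>j=a..<b. D m j x)\<^sup>2) + expectation (\<lambda>x. g x * (D m b x)\<^sup>2)
      + 2 * expectation (\<lambda>x. (g x * (\<Sum>j=a..<b. D m j x)) * D m b x)"
  proof -
    have "integrable M (\<lambda>x. g x * (\<Sum>j=a..<b. D m j x)\<^sup>2)" "integrable M (\<lambda>x. g x * (D m b x)\<^sup>2)"
      "integrable M (\<lambda>x. (g x * (\<Sum>j=a..<b. D m j x)) * D m b x)"
      by (intro bdd_meas_integrable bdd_meas_mult bdd_meas_power2 M)+
    then show ?thesis by simp
  qed
  also have "expectation (\<lambda>x. (g x * (\<Sum>j=a..<b. D m j x)) * D m b x) = 0"
    using b gF AF by (intro D_orth bdd_meas_mult) auto
  finally show ?case using step by simp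
qed

text \<open>Summing over all \<open>i\<close> lets sums over \<open>j\<close> telescope for each
  \<open>i\<close> separately. The limit \<open>i \<le> Suc j + m\<close> becomes
  \<open>i - Suc m \<le> j\<close>, also when the subtraction truncates; terms with
  \<open>i \<le> j\<close> vanish because \<open>X i\<close> is already known.\<close>

lemma D_alt: "D m j x = (\<Sum>i=1..n. if i - Suc m \<le> j then cexp (Suc j) i x - cexp j i x else 0)"
proof -
  have "(\<Sum>i=1..n. if i - Suc m \<le> j then cexp (Suc j) i x - cexp j i x else 0) =
      (\<Sum>i\<in>{Suc j..min n (Suc j + m)}. cexp (Suc j) i x - cexp j i x)"
    by (rule sum.mono_neutral_cong_right) (auto simp: cexp_self)
  then show ?thesis by (simp add: D_def P_def Q_def sum_subtractf)
qed

lemma sum_D: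
  assumes "a \<le> b"
  shows "(\<Sum>j=a..<b. D m j x) = (\<Sum>i=1..n.
    if max a (i - Suc m) \<le> b then cexp b i x - cexp (max a (i - Suc m)) i x else 0)"
  unfolding D_alt by (subst sum.swap) (intro sum.cong refl sum_from_Suc_diff assms)

text \<open>After telescoping, only \<open>X i\<close> with \<open>a < i \<le> b + m\<close>
  contribute, each at most \<open>2 C\<close>. The bound grows like the length plus
  \<open>m\<close>; adding up bounds for single differences would give the length times
  \<open>m\<close>.\<close>

lemma sum_D_bound:
  assumes "a \<le> b"
  shows "\<bar>\<Sum>j=a..<b. D m j x\<bar> \<le> 2 * C * real (b + m - a)"
proof -
  let ?f = "\<lambda>i. if max a (i - Suc m) \<le> b then cexp b i x - cexp (max a (i - Suc m)) i x else 0"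
  let ?I = "{1..n} \<inter> {Suc a..b + m}"
  have "(\<Sum>j=a..<b. D m j x) = sum ?f ?I"
    unfolding sum_D[OF assms]
  proof (rule sum.mono_neutral_right)
    show "\<forall>i\<in>{1..n} - ?I. ?f i = 0"
    proof
      fix i assume "i \<in> {1..n} - ?I"
      then have "i \<le> a \<or> i > b + m" by auto
      then consider "i \<le> a" | "i > b + m" by blast
      then show "?f i = 0"
      proof cases
        case 1 then show ?thesis using assms by (simp add: cexp_self)
      next
        case 2
        \<comment> \<open>The boundary case \<open>i = b + m + 1\<close> passes the test in the sum,
          but starts and ends at the same time \<open>b\<close>.\<close>
        then have "b \<le> i - Suc m" by simp
        then show ?thesis using assms by (cases "b = i - Suc m") (auto simp: max_def)
      qed
    qed
  qed auto
  also have "\<bar>\<dots>\<bar> \<le> (\<Sum>i\<in>?I. 2 * C)"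
  proof (rule order_trans[OF sum_abs sum_mono])
    fix i assume "i \<in> ?I"
    then show "\<bar>?f i\<bar> \<le> 2 * C"
      using cexp_bound[of i b x] cexp_bound[of i "max a (i - Suc m)" x] C_nonneg by auto
  qed
  also have "\<dots> = real (card ?I) * (2 * C)" by simp
  also have "\<dots> \<le> real (card {Suc a..b + m}) * (2 * C)"
    using C_nonneg by (intro mult_right_mono of_nat_mono card_mono) auto
  finally show ?thesis by (simp add: mult_ac)
qed

lemma D_bound: "\<bar>D m j x\<bar> \<le> 2 * (C * (real m + 1))"
  using sum_D_bound[of j "Suc j" m x] by (simp add: mult_ac add_ac)

lemma PQ_bound: "\<bar>P m j x\<bar> \<le> C * (real m + 1)" "\<bar>Q m j x\<bar> \<le> C * (real m + 1)"
proof -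
  let ?I = "{Suc j..min n (Suc j + m)}"
  have "real (card ?I) * C \<le> real (Suc m) * C"
    using C_nonneg by (intro mult_right_mono of_nat_mono) auto
  then have c: "(\<Sum>i\<in>?I. C) \<le> C * (real m + 1)" by (simp add: mult_ac add_ac)
  have "\<bar>P m j x\<bar> \<le> (\<Sum>i\<in>?I. C)" unfolding P_def
    by (intro order_trans[OF sum_abs sum_mono] cexp_bound) auto
  with c show "\<bar>P m j x\<bar> \<le> C * (real m + 1)" by simp
  have "\<bar>Q m j x\<bar> \<le> (\<Sum>i\<in>?I. C)" unfolding Q_def
    by (intro order_trans[OF sum_abs sum_mono] cexp_bound) auto
  with c show "\<bar>Q m j x\<bar> \<le> C * (real m + 1)" by simp
qed

section \<open>Remainder and variance of the sum\<close>

abbreviation S :: "'a \<Rightarrow> real" where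
  "S x \<equiv> \<Sum>i=1..n. X i x"

lemma X_M: "i \<in> {1..n} \<Longrightarrow> X i \<in> bdd_meas M"
  using G_M[OF X_G] by simp

lemma S_M: "S \<in> bdd_meas M"
  by (intro bdd_meas_sum X_M)

lemma sum_D_eq: "(\<Sum>j<n. D m j x) = S x - (\<Sum>i=1..n. cexp (i - Suc m) i x)"
proof -
  have "(\<Sum>j=0..<n. D m j x) = (\<Sum>i=1..n. X i x - cexp (i - Suc m) i x)"
    unfolding sum_D[OF zero_le] by (intro sum.cong) (auto simp: cexp_self)
  then show ?thesis by (simp add: sum_subtractf atLeast0LessThan)
qed

lemma remainder_L1:
  "expectation (\<lambda>x. \<bar>\<Sum>i=1..n. cexp (i - Suc m) i x\<bar>) \<le> real n * (C * r ^ m)"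
proof -
  have "expectation (\<lambda>x. \<bar>\<Sum>i=1..n. cexp (i - Suc m) i x\<bar>) \<le>
      expectation (\<lambda>x. \<Sum>i=1..n. \<bar>cexp (i - Suc m) i x\<bar>)"
    by (intro integral_mono bdd_meas_integrable bdd_meas_abs bdd_meas_sum cexp_M sum_abs)
  also have "\<dots> = (\<Sum>i=1..n. expectation (\<lambda>x. \<bar>cexp (i - Suc m) i x\<bar>))"
    by (intro Bochner_Integration.integral_sum bdd_meas_integrable bdd_meas_abs cexp_M)
  also have "\<dots> \<le> (\<Sum>i=1..n. C * r ^ m)"
  proof (rule sum_mono)
    fix i assume i: "i \<in> {1..n}"
    have "expectation (\<lambda>x. \<bar>cexp (i - Suc m) i x\<bar>) \<le> l2 (cexp (i - Suc m) i)"
      by (rule expectation_abs_le_sqrt[OF cexp_M[OF i]])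
    also have "\<dots> \<le> C * r ^ m"
    proof (cases "i \<le> Suc m")
      case True
      then show ?thesis using cexp_0[OF i] C_nonneg r by simp
    next
      case False
      have "l2 (cexp (i - Suc m) i) \<le> C * r ^ (i - (i - Suc m))" by (rule cexp_l2[OF i]) simp
      also have "i - (i - Suc m) = Suc m" using False by simp
      also have "C * r ^ Suc m \<le> C * r ^ m"
        using C_nonneg r by (intro mult_left_mono power_decreasing) auto
      finally show ?thesis .
    qed
    finally show "expectation (\<lambda>x. \<bar>cexp (i - Suc m) i x\<bar>) \<le> C * r ^ m" .
  qed
  finally show ?thesis by simp
qed

text \<open>
  With \<open>m = n\<close> nothing is truncated, and \<open>X k = P n (k - 1) - Q n k\<close>, where \<open>Q n k\<close> is the
  projection of \<open>P n k\<close>.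
\<close>

lemma variance_lower_bound:
  "(1 - r) / 4 * (\<Sum>i=1..n. expectation (\<lambda>x. (X i x)\<^sup>2)) \<le> expectation (\<lambda>x. (S x)\<^sup>2)"
proof -
  let ?p = "\<lambda>j. expectation (\<lambda>x. (P n j x)\<^sup>2)" and ?q = "\<lambda>j. expectation (\<lambda>x. (Q n j x)\<^sup>2)"
  have q_le: "?q j \<le> r * ?p j" "?q j \<le> ?p j" if "j < n" for j
  proof -
    have "l2 (Q n j) \<le> r * l2 (P n j)"
      using projection_contracts[OF that P_G Q_G P_mean P_proj[OF that]] .
    then have "(l2 (Q n j))\<^sup>2 \<le> (r * l2 (P n j))\<^sup>2" by (intro power_mono) auto
    then have "?q j \<le> r\<^sup>2 * ?p j" by (simp add: power_mult_distrib)
    also have "r\<^sup>2 * ?p j \<le> r * ?p j" using r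
      by (intro mult_right_mono) (auto simp: power2_eq_square mult_left_le_one_le)
    finally show *: "?q j \<le> r * ?p j" .
    also have "\<dots> \<le> ?p j" using r by (intro mult_left_le_one_le) auto
    finally show "?q j \<le> ?p j" .
  qed
  have XPQ: "X (Suc j) x = P n j x - Q n (Suc j) x" if "j < n" for j x
  proof -
    have "{Suc j..n} = insert (Suc j) {Suc (Suc j)..n}" using that by auto
    then show ?thesis by (simp add: P_def Q_def cexp_self)
  qed
  have Qn: "?q n = 0" by (simp add: Q_def)
  have X2: "expectation (\<lambda>x. (X (Suc j) x)\<^sup>2) \<le> 2 * ?p j + 2 * ?q (Suc j)" if "j < n" for j
  proof -
    have i: "integrable M (\<lambda>x. (P n j x)\<^sup>2)" "integrable M (\<lambda>x. (Q n (Suc j) x)\<^sup>2)"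
      "integrable M (\<lambda>x. (X (Suc j) x)\<^sup>2)"
      using that by (intro bdd_meas_integrable bdd_meas_power2 P_M Q_M X_M; simp)+
    have "expectation (\<lambda>x. (X (Suc j) x)\<^sup>2) \<le> expectation (\<lambda>x. 2 * (P n j x)\<^sup>2 + 2 * (Q n (Suc j) x)\<^sup>2)"
    proof (rule integral_mono)
      fix x
      have "0 \<le> (P n j x + Q n (Suc j) x)\<^sup>2" by simp
      then show "(X (Suc j) x)\<^sup>2 \<le> 2 * (P n j x)\<^sup>2 + 2 * (Q n (Suc j) x)\<^sup>2"
        unfolding XPQ[OF that] by (simp add: power2_diff power2_sum)
    qed (use i in auto)
    then show ?thesis using i by simp
  qed
  have "(\<Sum>i=1..n. expectation (\<lambda>x. (X i x)\<^sup>2)) = (\<Sum>j<n. expectation (\<lambda>x. (X (Suc j) x)\<^sup>2))"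
    by (simp add: sum.atLeast1_atMost_eq)
  also have "\<dots> \<le> (\<Sum>j<n. 2 * ?p j + 2 * ?q (Suc j))"
    by (intro sum_mono X2) auto
  also have "\<dots> = 2 * (\<Sum>j<n. ?p j) + 2 * (\<Sum>j<n. ?q (Suc j))"
    by (simp add: sum.distrib sum_distrib_left)
  \<comment> \<open>The index shift costs nothing: \<open>?q 0\<close> is nonnegative and
    \<open>Q n n\<close> is an empty sum. With \<open>?q j \<le> ?p j\<close> the constants add up
    to the 4 of the statement.\<close>
  also have "(\<Sum>j<n. ?q (Suc j)) \<le> (\<Sum>j<n. ?p j)"
  proof -
    have "(\<Sum>j<n. ?q (Suc j)) \<le> (\<Sum>j<Suc n. ?q j)"
      unfolding sum.lessThan_Suc_shift by simp
    also have "\<dots> = (\<Sum>j<n. ?q j)" using Qn by simp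
    also have "\<dots> \<le> (\<Sum>j<n. ?p j)" by (intro sum_mono q_le) auto
    finally show ?thesis .
  qed
  finally have Xp: "(\<Sum>i=1..n. expectation (\<lambda>x. (X i x)\<^sup>2)) \<le> 4 * (\<Sum>j<n. ?p j)" by simp
  have R0: "AE x in M. (\<Sum>i=1..n. cexp 0 i x) = 0"
  proof -
    have "AE x in M. \<forall>i\<in>{1..n}. cexp 0 i x = 0"
    proof (subst AE_ball_countable, simp, intro ballI)
      fix i assume i: "i \<in> {1..n}"
      have "expectation (\<lambda>x. (cexp 0 i x)\<^sup>2) = 0" using cexp_0[OF i] by simp
      then show "AE x in M. cexp 0 i x = 0"
        using cexp_M[OF i, of 0]
        by (subst (asm) integral_nonneg_eq_0_iff_AE) auto
    qed
    then show ?thesis by (auto elim!: eventually_mono)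
  qed
  have "(1 - r) * (\<Sum>j<n. ?p j) = (\<Sum>j<n. ?p j - r * ?p j)"
    by (simp add: algebra_simps sum_distrib_left sum_subtractf)
  \<comment> \<open>The second moment of \<open>D n j\<close> equals \<open>?p j - ?q j\<close>, and
    contraction of the projection leaves at least the fraction \<open>1 - r\<close> of
    \<open>?p j\<close>.\<close>
  also have "\<dots> \<le> (\<Sum>j<n. expectation (\<lambda>x. (D n j x)\<^sup>2))"
  proof (rule sum_mono)
    fix j assume "j \<in> {..<n}"
    then show "?p j - r * ?p j \<le> expectation (\<lambda>x. (D n j x)\<^sup>2)"
      using D_square[of j "\<lambda>_. 1" n] q_le(1)[of j] by simp
  qed
  also have "\<dots> = expectation (\<lambda>x. (\<Sum>j<n. D n j x)\<^sup>2)"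
    using D_sum_square[of 0 n "\<lambda>_. 1" n] by (simp add: atLeast0LessThan)
  also have "\<dots> = expectation (\<lambda>x. (S x)\<^sup>2)"
  proof (rule integral_cong_AE)
    show "AE x in M. (\<Sum>j<n. D n j x)\<^sup>2 = (S x)\<^sup>2"
      using R0 by (auto elim!: eventually_mono simp: sum_D_eq)
  qed (intro bdd_meas_measurable[of _ M] bdd_meas_power2 bdd_meas_sum D_M X_M; simp)+
  finally have "(1 - r) * (\<Sum>j<n. ?p j) \<le> expectation (\<lambda>x. (S x)\<^sup>2)" .
  moreover have "(1 - r) / 4 * (\<Sum>i=1..n. expectation (\<lambda>x. (X i x)\<^sup>2)) \<le> (1 - r) / 4 * (4 * (\<Sum>j<n. ?p j))"
    using r by (intro mult_left_mono Xp) auto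
  moreover have "(1 - r) / 4 * (4 * (\<Sum>j<n. ?p j)) = (1 - r) * (\<Sum>j<n. ?p j)" by simp
  ultimately show ?thesis by linarith
qed

section \<open>Concentration of the quadratic variation\<close>

abbreviation s2 :: "nat \<Rightarrow> real" where
  "s2 m \<equiv> \<Sum>j<n. expectation (\<lambda>x. (D m j x)\<^sup>2)"

text \<open>
  Covariances of \<open>(D m l)\<^sup>2\<close> with later terms: those at distance at most \<open>m\<close> sum up, by
  orthogonality, to a second moment of \<open>\<Sum>j. D m j\<close> over a short interval, which telescopes to a
  bounded variable; the remaining ones are exponentially small by mixing.
\<close>

lemma covariance_far:
  assumes "l < j" "j < n"
  shows "expectation (\<lambda>x. (D m l x)\<^sup>2 * (D m j x)\<^sup>2) -
      expectation (\<lambda>x. (D m l x)\<^sup>2) * expectation (\<lambda>x. (D m j x)\<^sup>2)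
    \<le> 8 * (C * (real m + 1)) ^ 4 * r ^ (j - Suc l)"
proof -
  define H where "H = C * (real m + 1)"
  have H0: "0 \<le> H" using C_nonneg by (simp add: H_def)
  have lF: "(\<lambda>x. (D m l x)\<^sup>2) \<in> bdd_meas (F (Suc l))"
    using assms by (intro bdd_meas_power2 D_F) auto
  have lb: "\<bar>(D m l x)\<^sup>2\<bar> \<le> (2 * H)\<^sup>2" for x
    using power_mono[OF D_bound[of m l x], of 2] by (simp add: H_def)
  have lM: "(\<lambda>x. (D m l x)\<^sup>2) \<in> bdd_meas M" using F_M[OF lF] assms by simp
  \<comment> \<open>Mixing for the centred square of \<open>h\<close>: the test function
    \<open>(D m l)^2\<close> is at most \<open>4 H^2\<close>, and the centred square has
    \<open>L2\<close> norm at most \<open>H^2\<close>. Using this for \<open>P\<close> and for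
    \<open>Q\<close> gives the factor 8.\<close>
  have cov: "\<bar>expectation (\<lambda>x. (D m l x)\<^sup>2 * (h x)\<^sup>2) - expectation (\<lambda>x. (D m l x)\<^sup>2) * expectation (\<lambda>x. (h x)\<^sup>2)\<bar>
      \<le> 4 * H ^ 4 * r ^ (k - Suc l)"
    if h: "h \<in> bdd_meas (G k)" "\<And>x. \<bar>h x\<bar> \<le> H" and k: "Suc l \<le> k" "k \<le> n" for h k
  proof -
    let ?h = "\<lambda>x. (h x)\<^sup>2 - expectation (\<lambda>x. (h x)\<^sup>2)"
    have hG: "?h \<in> bdd_meas (G k)" using h by (intro bdd_meas_diff bdd_meas_power2 bdd_meas_const)
    have hM: "h \<in> bdd_meas M" using G_M h k by auto
    have i: "integrable M (\<lambda>x. (h x)\<^sup>2)" "integrable M (\<lambda>x. ((h x)\<^sup>2)\<^sup>2)"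
      "integrable M (\<lambda>x. (D m l x)\<^sup>2 * (h x)\<^sup>2)" "integrable M (\<lambda>x. (D m l x)\<^sup>2)"
      by (intro bdd_meas_integrable bdd_meas_power2 bdd_meas_mult hM lM)+
    have h0: "expectation ?h = 0" using i by (simp add: prob_space)
    have "expectation (\<lambda>x. (?h x)\<^sup>2) = expectation (\<lambda>x. ((h x)\<^sup>2)\<^sup>2) - (expectation (\<lambda>x. (h x)\<^sup>2))\<^sup>2"
      using i by (intro variance_eq) auto
    also have "\<dots> \<le> expectation (\<lambda>x. ((h x)\<^sup>2)\<^sup>2)" by simp
    also have "\<dots> \<le> expectation (\<lambda>x. (H\<^sup>2)\<^sup>2)"
    proof (rule integral_mono)
      fix x
      have "(h x)\<^sup>2 \<le> H\<^sup>2" using h(2)[of x] H0 by (simp only: power2_le_iff_abs_le)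
      then show "((h x)\<^sup>2)\<^sup>2 \<le> (H\<^sup>2)\<^sup>2" by (rule power_mono) simp
    qed (use i in auto)
    finally have "l2 ?h \<le> H\<^sup>2" by (simp add: prob_space real_le_lsqrt)
    then have "(2 * H)\<^sup>2 * r ^ (k - Suc l) * l2 ?h \<le> (2 * H)\<^sup>2 * r ^ (k - Suc l) * H\<^sup>2"
      using r by (intro mult_left_mono) auto
    then have "\<bar>expectation (\<lambda>x. (D m l x)\<^sup>2 * ?h x)\<bar> \<le> (2 * H)\<^sup>2 * r ^ (k - Suc l) * H\<^sup>2"
      using mixing[OF k hG h0 lF lb] by linarith
    also have "\<dots> = 4 * H ^ 4 * r ^ (k - Suc l)" by (simp add: power2_eq_square power4_eq_xxxx)
    finally show ?thesis using i by (simp add: right_diff_distrib mult_ac)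
  qed
  note PQ = PQ_bound[of m j, folded H_def]
  have cP: "\<bar>expectation (\<lambda>x. (D m l x)\<^sup>2 * (P m j x)\<^sup>2) - expectation (\<lambda>x. (D m l x)\<^sup>2) * expectation (\<lambda>x. (P m j x)\<^sup>2)\<bar>
      \<le> 4 * H ^ 4 * r ^ (Suc j - Suc l)"
    using assms by (intro cov P_G PQ) auto
  have cQ: "\<bar>expectation (\<lambda>x. (D m l x)\<^sup>2 * (Q m j x)\<^sup>2) - expectation (\<lambda>x. (D m l x)\<^sup>2) * expectation (\<lambda>x. (Q m j x)\<^sup>2)\<bar>
      \<le> 4 * H ^ 4 * r ^ (j - Suc l)"
    using assms by (intro cov Q_G PQ) auto
  have "r ^ (Suc j - Suc l) \<le> r ^ (j - Suc l)" using r by (intro power_decreasing) auto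
  then have "4 * H ^ 4 * r ^ (Suc j - Suc l) \<le> 4 * H ^ 4 * r ^ (j - Suc l)"
    by (intro mult_left_mono) auto
  moreover have "expectation (\<lambda>x. (D m l x)\<^sup>2 * (D m j x)\<^sup>2) =
     expectation (\<lambda>x. (D m l x)\<^sup>2 * (P m j x)\<^sup>2) - expectation (\<lambda>x. (D m l x)\<^sup>2 * (Q m j x)\<^sup>2)"
    using assms lF by (intro D_square F_up[OF _ _ lF]) auto
  moreover have "expectation (\<lambda>x. (D m j x)\<^sup>2) = expectation (\<lambda>x. (P m j x)\<^sup>2) - expectation (\<lambda>x. (Q m j x)\<^sup>2)"
    using D_square[of j "\<lambda>_. 1" m] assms by simp
  ultimately show ?thesis using cP cQ unfolding H_def[symmetric]
    by (simp add: right_diff_distrib abs_le_iff)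
qed

lemma covariance_near:
  assumes "Suc l \<le> b" "b \<le> n" "b \<le> Suc l + m"
  shows "(\<Sum>j=Suc l..<b. expectation (\<lambda>x. (D m l x)\<^sup>2 * (D m j x)\<^sup>2)) \<le>
    16 * (C * (real m + 1))\<^sup>2 * expectation (\<lambda>x. (D m l x)\<^sup>2)"
proof -
  define H where "H = C * (real m + 1)"
  have H0: "0 \<le> H" using C_nonneg by (simp add: H_def)
  have lF: "(\<lambda>x. (D m l x)\<^sup>2) \<in> bdd_meas (F (Suc l))"
    using assms by (intro bdd_meas_power2 D_F) auto
  have lM: "(\<lambda>x. (D m l x)\<^sup>2) \<in> bdd_meas M" using F_M[OF lF] assms by simp
  have sM: "(\<lambda>x. \<Sum>j=Suc l..<b. D m j x) \<in> bdd_meas M"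
    using assms by (intro bdd_meas_sum D_M) auto
  \<comment> \<open>The interval has at most \<open>m\<close> steps, so the telescoped sum involves
    at most \<open>2 m\<close> variables.\<close>
  have b: "(\<Sum>j=Suc l..<b. D m j x)\<^sup>2 \<le> (4 * H)\<^sup>2" for x
  proof -
    have "\<bar>\<Sum>j=Suc l..<b. D m j x\<bar> \<le> 2 * C * real (b + m - Suc l)"
      by (rule sum_D_bound[OF assms(1)])
    also have "\<dots> \<le> 2 * C * (2 * (real m + 1))"
      using assms C_nonneg by (intro mult_left_mono) auto
    also have "\<dots> = 4 * H" by (simp add: H_def)
    finally show ?thesis using H0 by (subst power2_le_iff_abs_le) auto
  qed
  have "(\<Sum>j=Suc l..<b. expectation (\<lambda>x. (D m l x)\<^sup>2 * (D m j x)\<^sup>2)) =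
      expectation (\<lambda>x. (D m l x)\<^sup>2 * (\<Sum>j=Suc l..<b. D m j x)\<^sup>2)"
    by (rule D_sum_square[OF assms(1,2) lF, symmetric])
  also have "\<dots> \<le> expectation (\<lambda>x. (D m l x)\<^sup>2 * (4 * H)\<^sup>2)"
    using b lM sM by (intro integral_mono bdd_meas_integrable mult_left_mono) auto
  also have "\<dots> = 16 * H\<^sup>2 * expectation (\<lambda>x. (D m l x)\<^sup>2)" by (simp add: power_mult_distrib)
  finally show ?thesis unfolding H_def .
qed

text \<open>Expanding the square, each index \<open>l\<close> contributes, with
  \<open>H = C (m + 1)\<close> and \<open>d l\<close> the second moment of \<open>D m l\<close>,
  \<open>4 H^2 * d l\<close> on the diagonal, \<open>16 H^2 * d l\<close> from near and
  \<open>8 n H^4 r^m\<close> from far covariances. Covariances count twice: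
  \<open>36 = 4 + 2 * 16\<close> and \<open>16 = 2 * 8\<close>. The main term is linear in
  \<open>s2 m\<close>, hence negligible against its square once \<open>H^2\<close> is small compared
  with \<open>s2 m\<close>.\<close>

lemma quadratic_variation_concentration:
  "expectation (\<lambda>x. ((\<Sum>j<n. (D m j x)\<^sup>2) - s2 m)\<^sup>2) \<le>
     36 * (C * (real m + 1))\<^sup>2 * s2 m + 16 * (real n)\<^sup>2 * (C * (real m + 1)) ^ 4 * r ^ m"
proof -
  define H where "H = C * (real m + 1)"
  define d where "d j = expectation (\<lambda>x. (D m j x)\<^sup>2)" for j
  define Y where "Y j x = (D m j x)\<^sup>2 - d j" for j x
  have YM: "Y j \<in> bdd_meas M" if "j < n" for j
    unfolding Y_def[abs_def] using that by (intro bdd_meas_diff bdd_meas_power2 D_M bdd_meas_const)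
  have DM2: "(\<lambda>x. (D m j x)\<^sup>2) \<in> bdd_meas M" if "j < n" for j
    using that by (intro bdd_meas_power2 D_M)
  have d0: "0 \<le> d j" for j by (simp add: d_def)
  have YY: "expectation (\<lambda>x. Y l x * Y j x) = expectation (\<lambda>x. (D m l x)\<^sup>2 * (D m j x)\<^sup>2) - d l * d j"
    if "l < n" "j < n" for l j
  proof -
    have i: "integrable M (\<lambda>x. (D m l x)\<^sup>2 * (D m j x)\<^sup>2)" "integrable M (\<lambda>x. (D m l x)\<^sup>2)" "integrable M (\<lambda>x. (D m j x)\<^sup>2)"
      by (intro bdd_meas_integrable bdd_meas_mult DM2 that)+
    have "expectation (\<lambda>x. Y l x * Y j x) =
      expectation (\<lambda>x. (D m l x)\<^sup>2 * (D m j x)\<^sup>2 - (d j * (D m l x)\<^sup>2 + d l * (D m j x)\<^sup>2 - d l * d j))"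
      by (intro Bochner_Integration.integral_cong) (auto simp: Y_def algebra_simps)
    also have "\<dots> = expectation (\<lambda>x. (D m l x)\<^sup>2 * (D m j x)\<^sup>2) - (d j * d l + d l * d j - d l * d j)"
      using i by (simp add: prob_space d_def)
    finally show ?thesis by simp
  qed
  let ?c = "\<lambda>l. 36 * H\<^sup>2 * d l + 16 * real n * H ^ 4 * r ^ m"
  have diag: "expectation (\<lambda>x. (Y l x)\<^sup>2) \<le> 4 * H\<^sup>2 * d l" if "l < n" for l
  proof -
    have "expectation (\<lambda>x. (Y l x)\<^sup>2) \<le> expectation (\<lambda>x. (D m l x)\<^sup>2 * (D m l x)\<^sup>2)"
      using YY[OF that that] d0[of l] by (simp add: power2_eq_square)
    also have "\<dots> \<le> expectation (\<lambda>x. (2 * H)\<^sup>2 * (D m l x)\<^sup>2)"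
    proof (intro integral_mono bdd_meas_integrable bdd_meas_mult DM2 that bdd_meas_const mult_right_mono)
      show "(D m l x)\<^sup>2 \<le> (2 * H)\<^sup>2" for x
        using power_mono[OF D_bound[of m l x], of 2] by (simp add: H_def)
    qed auto
    also have "\<dots> = 4 * H\<^sup>2 * d l" by (simp add: d_def power_mult_distrib)
    finally show ?thesis .
  qed
  have cross: "expectation (\<lambda>x. Y l x * (\<Sum>j=Suc l..<n. Y j x)) \<le> 16 * H\<^sup>2 * d l + 8 * real n * H ^ 4 * r ^ m"
    if "l < n" for l
  proof -
    define b where "b = min n (Suc l + m)"
    have b: "Suc l \<le> b" "b \<le> n" "b \<le> Suc l + m" using that by (auto simp: b_def)
    have "expectation (\<lambda>x. Y l x * (\<Sum>j=Suc l..<n. Y j x)) = (\<Sum>j=Suc l..<n. expectation (\<lambda>x. Y l x * Y j x))"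
      unfolding sum_distrib_left using that
      by (intro Bochner_Integration.integral_sum bdd_meas_integrable bdd_meas_mult YM) auto
    also have "\<dots> = (\<Sum>j=Suc l..<b. expectation (\<lambda>x. Y l x * Y j x)) + (\<Sum>j=b..<n. expectation (\<lambda>x. Y l x * Y j x))"
      using b by (intro sum.atLeastLessThan_concat[symmetric]) auto
    \<comment> \<open>Only upper bounds are needed, so for near pairs the products
      \<open>d l * d j\<close> are dropped.\<close>
    also have "(\<Sum>j=Suc l..<b. expectation (\<lambda>x. Y l x * Y j x)) \<le>
        (\<Sum>j=Suc l..<b. expectation (\<lambda>x. (D m l x)\<^sup>2 * (D m j x)\<^sup>2))"
      using that b d0 by (intro sum_mono) (auto simp: YY)
    also have "\<dots> \<le> 16 * H\<^sup>2 * d l"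
      using covariance_near[OF b] by (simp add: H_def d_def)
    also have "(\<Sum>j=b..<n. expectation (\<lambda>x. Y l x * Y j x)) \<le> (\<Sum>j=b..<n. 8 * H ^ 4 * r ^ m)"
    proof (rule sum_mono)
      fix j assume j: "j \<in> {b..<n}"
      then have "j \<ge> Suc l + m" by (auto simp: b_def)
      then have "r ^ (j - Suc l) \<le> r ^ m" using r by (intro power_decreasing) auto
      then have "8 * H ^ 4 * r ^ (j - Suc l) \<le> 8 * H ^ 4 * r ^ m" by (intro mult_left_mono) auto
      moreover have "expectation (\<lambda>x. Y l x * Y j x) \<le> 8 * H ^ 4 * r ^ (j - Suc l)"
        using covariance_far[of l j m] j b YY[of l j] that by (simp add: H_def d_def)
      ultimately show "expectation (\<lambda>x. Y l x * Y j x) \<le> 8 * H ^ 4 * r ^ m" by linarith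
    qed
    also have "\<dots> = real (n - b) * (8 * H ^ 4 * r ^ m)" by simp
    also have "\<dots> \<le> real n * (8 * H ^ 4 * r ^ m)" using r by (intro mult_right_mono) auto
    finally show ?thesis by simp
  qed
  have "expectation (\<lambda>x. (\<Sum>j=l..<n. Y j x)\<^sup>2) \<le> (\<Sum>j=l..<n. ?c j)" if "l \<le> n" for l
    using that
  proof (induction l rule: inc_induct)
    case base
    then show ?case by simp
  next
    case (step l)
    let ?R = "\<lambda>x. \<Sum>j=Suc l..<n. Y j x"
    have RM: "?R \<in> bdd_meas M" by (intro bdd_meas_sum YM) auto
    have i: "integrable M (\<lambda>x. (Y l x)\<^sup>2)" "integrable M (\<lambda>x. Y l x * ?R x)" "integrable M (\<lambda>x. (?R x)\<^sup>2)"
      by (intro bdd_meas_integrable bdd_meas_power2 bdd_meas_mult YM RM step)+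
    have "expectation (\<lambda>x. (\<Sum>j=l..<n. Y j x)\<^sup>2) =
        expectation (\<lambda>x. (Y l x)\<^sup>2 + 2 * (Y l x * ?R x) + (?R x)\<^sup>2)"
      using step by (intro Bochner_Integration.integral_cong) (auto simp: sum.atLeast_Suc_lessThan power2_sum)
    also have "\<dots> = expectation (\<lambda>x. (Y l x)\<^sup>2) + 2 * expectation (\<lambda>x. Y l x * ?R x) + expectation (\<lambda>x. (?R x)\<^sup>2)"
      using i by simp
    also have "\<dots> \<le> ?c l + (\<Sum>j=Suc l..<n. ?c j)"
      using diag[of l] cross[of l] step by simp
    also have "\<dots> = (\<Sum>j=l..<n. ?c j)" using step by (simp add: sum.atLeast_Suc_lessThan)
    finally show ?case .
  qed
  from this[of 0] have "expectation (\<lambda>x. (\<Sum>j<n. Y j x)\<^sup>2) \<le> (\<Sum>j<n. ?c j)"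
    by (simp add: atLeast0LessThan)
  also have "\<dots> = 36 * H\<^sup>2 * (\<Sum>j<n. d j) + 16 * (real n)\<^sup>2 * H ^ 4 * r ^ m"
    by (simp add: sum.distrib sum_distrib_left power2_eq_square)
  finally show ?thesis by (simp add: Y_def H_def d_def sum_subtractf)
qed

section \<open>Quantitative normal approximation\<close>

text \<open>Replacing the sum by its martingale part costs \<open>u |t|\<close>. The normalised
  differences are bounded by \<open>B = 2 u\<close>, which turns \<open>6 |t|^3 B\<close> into
  \<open>12 |t|^3 u\<close>. The normalised quadratic variation differs from 1 in mean by at most
  \<open>9 u + 3 u^2 \<le> 11 u\<close>. The condition \<open>u \<le> 1 / 2\<close> ensures
  \<open>B \<le> 1\<close> and \<open>u^2 \<le> u / 2\<close>.\<close>

theorem char_bound: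
  fixes t \<sigma> :: real and m :: nat
  defines "u \<equiv> C * (real m + 1) / \<sigma>"
  assumes \<sigma>: "\<sigma> > 0" "expectation (\<lambda>x. (S x)\<^sup>2) = \<sigma>\<^sup>2" and m: "(real n)\<^sup>2 * r ^ m \<le> 1" and u: "u \<le> 1 / 2"
  shows "cmod ((CLINT x|M. iexp (t * (S x / \<sigma>))) - exp (- t\<^sup>2 / 2)) \<le>
    u * (\<bar>t\<bar> + 12 * \<bar>t\<bar> ^ 3 + 11 * (2 + t\<^sup>2 * exp (3 * t\<^sup>2 / 2)))"
proof -
  define H where "H = C * (real m + 1)"
  define R where "R x = (\<Sum>i=1..n. cexp (i - Suc m) i x)" for x
  define N where "N x = (\<Sum>j<n. D m j x)" for x
  define V where "V x = (\<Sum>j<n. (D m j x)\<^sup>2)" for x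
  have H: "H = u * \<sigma>" using \<sigma> by (simp add: H_def u_def)
  have u0: "0 \<le> u" using \<sigma> C_nonneg by (simp add: u_def)
  have CH: "C \<le> H" using C_nonneg by (simp add: H_def mult_le_cancel_left1)
  have N: "N x = S x - R x" for x by (simp add: N_def R_def sum_D_eq)
  have RM: "R \<in> bdd_meas M" unfolding R_def[abs_def] by (intro bdd_meas_sum cexp_M)
  have NM: "N \<in> bdd_meas M" unfolding N_def[abs_def] by (intro bdd_meas_sum D_M) auto
  have VM: "V \<in> bdd_meas M" unfolding V_def[abs_def] by (intro bdd_meas_sum bdd_meas_power2 D_M) auto
  have intR: "integrable M (\<lambda>x. \<bar>R x\<bar>)" using RM by auto
  have [measurable]: "S \<in> borel_measurable M" "N \<in> borel_measurable M"
    using S_M NM bdd_meas_measurable by auto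
  have eR: "expectation (\<lambda>x. \<bar>R x\<bar>) \<le> real n * (C * r ^ m)"
    unfolding R_def by (rule remainder_L1)
  have nR: "real n * expectation (\<lambda>x. \<bar>R x\<bar>) \<le> C"
  proof -
    have "real n * expectation (\<lambda>x. \<bar>R x\<bar>) \<le> real n * (real n * (C * r ^ m))"
      using eR by (intro mult_left_mono) auto
    also have "\<dots> = C * ((real n)\<^sup>2 * r ^ m)" by (simp add: power2_eq_square)
    also have "\<dots> \<le> C * 1" using C_nonneg m by (intro mult_left_mono) auto
    finally show ?thesis by simp
  qed
  have R1: "expectation (\<lambda>x. \<bar>R x\<bar>) \<le> C"
  proof -
    have "real n * r ^ m \<le> (real n)\<^sup>2 * r ^ m"
      using r by (intro mult_right_mono) (auto simp: power2_eq_square simp flip: of_nat_mult)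
    then have "C * (real n * r ^ m) \<le> C * 1" using C_nonneg m by (intro mult_left_mono) auto
    then show ?thesis using eR by (simp add: mult_ac)
  qed
  have s2: "s2 m = expectation (\<lambda>x. (N x)\<^sup>2)"
    using D_sum_square[of 0 n "\<lambda>_. 1" m] by (simp add: N_def atLeast0LessThan)
  \<comment> \<open>Since \<open>N^2 - S^2 = (R - 2 S) R\<close> and
    \<open>|R - 2 S| \<le> 3 n C\<close> pointwise, the \<open>L1\<close> bound for \<open>R\<close>
    is enough; the extra factor \<open>n\<close> is absorbed by
    \<open>n^2 r^m \<le> 1\<close>.\<close>
  have s2_diff: "\<bar>s2 m - \<sigma>\<^sup>2\<bar> \<le> 3 * H\<^sup>2"
  proof -
    have "\<bar>s2 m - \<sigma>\<^sup>2\<bar> = \<bar>expectation (\<lambda>x. (N x)\<^sup>2 - (S x)\<^sup>2)\<bar>"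
      using NM S_M \<sigma> s2 by (subst Bochner_Integration.integral_diff) auto
    also have "\<dots> \<le> expectation (\<lambda>x. \<bar>(N x)\<^sup>2 - (S x)\<^sup>2\<bar>)" by (rule integral_abs_bound)
    also have "\<dots> \<le> expectation (\<lambda>x. 3 * real n * C * \<bar>R x\<bar>)"
    proof (intro integral_mono bdd_meas_integrable bdd_meas_abs bdd_meas_diff bdd_meas_power2 NM S_M bdd_meas_mult bdd_meas_const RM)
      fix x
      have "\<bar>S x\<bar> \<le> (\<Sum>i=1..n. C)" by (intro order_trans[OF sum_abs sum_mono] X_bound)
      moreover have "\<bar>R x\<bar> \<le> (\<Sum>i=1..n. C)" unfolding R_def
        by (intro order_trans[OF sum_abs sum_mono] cexp_bound)
      ultimately have "\<bar>R x - 2 * S x\<bar> \<le> 3 * real n * C" by simp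
      then have "\<bar>R x - 2 * S x\<bar> * \<bar>R x\<bar> \<le> 3 * real n * C * \<bar>R x\<bar>" by (intro mult_right_mono) auto
      moreover have "(N x)\<^sup>2 - (S x)\<^sup>2 = (R x - 2 * S x) * R x"
        unfolding N by (simp add: power2_eq_square algebra_simps)
      ultimately show "\<bar>(N x)\<^sup>2 - (S x)\<^sup>2\<bar> \<le> 3 * real n * C * \<bar>R x\<bar>" by (simp add: abs_mult)
    qed
    also have "\<dots> = 3 * C * (real n * expectation (\<lambda>x. \<bar>R x\<bar>))" by simp
    also have "\<dots> \<le> 3 * C * C" using nR C_nonneg by (intro mult_left_mono) auto
    also have "\<dots> \<le> 3 * (H * H)" using CH C_nonneg by (simp add: mult_mono)
    finally show ?thesis by (simp add: power2_eq_square)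
  qed
  have uu: "u\<^sup>2 \<le> u / 2" "u\<^sup>2 \<le> 1 / 4"
    using mult_left_mono[OF u u0] power_mono[OF u u0, of 2] by (auto simp: power2_eq_square)
  have V: "expectation (\<lambda>x. \<bar>V x - s2 m\<bar>) \<le> 9 * u * \<sigma>\<^sup>2"
  proof -
    have "expectation (\<lambda>x. (V x - s2 m)\<^sup>2) \<le> 36 * H\<^sup>2 * s2 m + 16 * (real n)\<^sup>2 * H ^ 4 * r ^ m"
      unfolding V_def H_def by (rule quadratic_variation_concentration)
    also have "16 * (real n)\<^sup>2 * H ^ 4 * r ^ m = 16 * H ^ 4 * ((real n)\<^sup>2 * r ^ m)" by simp
    also have "\<dots> \<le> 16 * H ^ 4 * 1" using m by (intro mult_left_mono) auto
    also have "36 * H\<^sup>2 * s2 m \<le> 36 * H\<^sup>2 * (\<sigma>\<^sup>2 + 3 * H\<^sup>2)"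
      using s2_diff by (intro mult_left_mono) auto
    also have "36 * H\<^sup>2 * (\<sigma>\<^sup>2 + 3 * H\<^sup>2) + 16 * H ^ 4 * 1 = \<sigma> ^ 4 * u\<^sup>2 * (36 + 124 * u\<^sup>2)"
      by (simp add: H power2_eq_square power4_eq_xxxx algebra_simps)
    \<comment> \<open>As \<open>u^2 \<le> 1 / 4\<close>, the bracket is at most 67; 81 is the next
      perfect square, for the root taken below.\<close>
    also have "\<dots> \<le> \<sigma> ^ 4 * u\<^sup>2 * 81" using uu by (intro mult_left_mono) auto
    also have "\<dots> = (9 * u * \<sigma>\<^sup>2)\<^sup>2" by (simp add: power2_eq_square power4_eq_xxxx)
    finally have "sqrt (expectation (\<lambda>x. (V x - s2 m)\<^sup>2)) \<le> 9 * u * \<sigma>\<^sup>2"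
      using u0 by (intro real_le_lsqrt) auto
    moreover have "expectation (\<lambda>x. \<bar>V x - s2 m\<bar>) \<le> sqrt (expectation (\<lambda>x. (V x - s2 m)\<^sup>2))"
      by (intro expectation_abs_le_sqrt bdd_meas_diff VM bdd_meas_const)
    ultimately show ?thesis by linarith
  qed
  have \<delta>: "expectation (\<lambda>x. \<bar>(\<Sum>j<n. (D m j x / \<sigma>)\<^sup>2) - 1\<bar>) \<le> 11 * u"
  proof -
    have "\<bar>(\<Sum>j<n. (D m j x / \<sigma>)\<^sup>2) - 1\<bar> \<le> (\<bar>V x - s2 m\<bar> + \<bar>s2 m - \<sigma>\<^sup>2\<bar>) / \<sigma>\<^sup>2" for x
    proof -
      have "(\<Sum>j<n. (D m j x / \<sigma>)\<^sup>2) - 1 = (V x - \<sigma>\<^sup>2) / \<sigma>\<^sup>2"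
        using \<sigma> by (simp add: V_def power_divide diff_divide_distrib flip: sum_divide_distrib)
      also have "\<bar>\<dots>\<bar> = \<bar>V x - \<sigma>\<^sup>2\<bar> / \<sigma>\<^sup>2" by simp
      finally show ?thesis by (simp add: divide_right_mono)
    qed
    then have "expectation (\<lambda>x. \<bar>(\<Sum>j<n. (D m j x / \<sigma>)\<^sup>2) - 1\<bar>) \<le>
       expectation (\<lambda>x. (\<bar>V x - s2 m\<bar> + \<bar>s2 m - \<sigma>\<^sup>2\<bar>) * (1 / \<sigma>\<^sup>2))"
      unfolding power_divide sum_divide_distrib[symmetric]
      by (intro integral_mono bdd_meas_integrable bdd_meas_abs bdd_meas_diff bdd_meas_mult bdd_meas_add VM bdd_meas_const)
        (use VM in \<open>auto simp: divide_inverse simp flip: V_def intro!: bdd_meas_mult\<close>)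
    also have "\<dots> = (expectation (\<lambda>x. \<bar>V x - s2 m\<bar>) + \<bar>s2 m - \<sigma>\<^sup>2\<bar>) * (1 / \<sigma>\<^sup>2)"
    proof -
      have "integrable M (\<lambda>x. \<bar>V x - s2 m\<bar>)"
        by (intro bdd_meas_integrable bdd_meas_abs bdd_meas_diff VM bdd_meas_const)
      then show ?thesis by (simp add: prob_space del: integral_divide_zero)
    qed
    also have "\<dots> \<le> (9 * u * \<sigma>\<^sup>2 + 3 * H\<^sup>2) * (1 / \<sigma>\<^sup>2)"
      using V s2_diff by (intro mult_right_mono add_mono) auto
    also have "\<dots> = 9 * u + 3 * u\<^sup>2" using \<sigma> by (simp add: H field_simps power_mult_distrib)
    also have "\<dots> \<le> 11 * u" using uu u0 by simp
    finally show ?thesis .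
  qed
  have c1: "cmod ((CLINT x|M. iexp (t * (\<Sum>j<n. D m j x / \<sigma>))) - exp (- t\<^sup>2 / 2)) \<le>
    6 * \<bar>t\<bar> ^ 3 * (2 * u) + (2 + t\<^sup>2 * exp (3 * t\<^sup>2 / 2)) * expectation (\<lambda>x. \<bar>(\<Sum>j<n. (D m j x / \<sigma>)\<^sup>2) - 1\<bar>)"
  proof (rule martingale_difference_char_bound[where F = F])
    show "(\<lambda>x. D m k x / \<sigma>) \<in> bdd_meas (F (Suc k))" if "k < n" for k
      using bdd_meas_mult[OF D_F[OF that] bdd_meas_const[of "1 / \<sigma>"]] by simp
    show "\<bar>D m k x / \<sigma>\<bar> \<le> 2 * u" for k x
      using D_bound[of m k x] \<sigma> by (simp add: u_def field_simps)
    show "expectation (\<lambda>x. g x * (D m k x / \<sigma>)) = 0" if "k < n" "g \<in> bdd_meas (F k)" for k g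
      using D_orth[OF that] by simp
  qed (use u u0 sub_F mono_F in auto)
  also have "\<dots> \<le> 6 * \<bar>t\<bar> ^ 3 * (2 * u) + (2 + t\<^sup>2 * exp (3 * t\<^sup>2 / 2)) * (11 * u)"
    by (intro add_left_mono mult_left_mono \<delta>) auto
  finally have c1: "cmod ((CLINT x|M. iexp (t * (N x / \<sigma>))) - exp (- t\<^sup>2 / 2)) \<le>
      6 * \<bar>t\<bar> ^ 3 * (2 * u) + (2 + t\<^sup>2 * exp (3 * t\<^sup>2 / 2)) * (11 * u)"
    by (simp add: N_def sum_divide_distrib del: of_real_sum of_real_mult)
  have c2: "cmod ((CLINT x|M. iexp (t * (S x / \<sigma>))) - (CLINT x|M. iexp (t * (N x / \<sigma>)))) \<le> u * \<bar>t\<bar>"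
  proof -
    have iS: "integrable M (\<lambda>x. iexp (t * (S x / \<sigma>)))"
    proof (rule integrable_const_bound[where B = 1])
      show "(\<lambda>x. iexp (t * (S x / \<sigma>))) \<in> borel_measurable M" by measurable
    qed simp
    have iN: "integrable M (\<lambda>x. iexp (t * (N x / \<sigma>)))"
    proof (rule integrable_const_bound[where B = 1])
      show "(\<lambda>x. iexp (t * (N x / \<sigma>))) \<in> borel_measurable M" by measurable
    qed simp
    have b: "cmod (iexp (t * (S x / \<sigma>)) - iexp (t * (N x / \<sigma>))) \<le> \<bar>t\<bar> / \<sigma> * \<bar>R x\<bar>" for x
    proof -
      have "t * (S x / \<sigma>) = t * (N x / \<sigma>) + t * (R x / \<sigma>)"
        unfolding N by (simp only: diff_divide_distrib) (simp add: right_diff_distrib)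
      then have "iexp (t * (S x / \<sigma>)) = iexp (t * (N x / \<sigma>)) * iexp (t * (R x / \<sigma>))"
        by (simp only: of_real_add distrib_left exp_add)
      then have "iexp (t * (S x / \<sigma>)) - iexp (t * (N x / \<sigma>)) = iexp (t * (N x / \<sigma>)) * (iexp (t * (R x / \<sigma>)) - 1)"
        by (simp only: right_diff_distrib mult_1_right)
      moreover have "cmod (iexp (t * (R x / \<sigma>)) - 1) \<le> \<bar>t * (R x / \<sigma>)\<bar>"
        using iexp_approx1[of "t * (R x / \<sigma>)" 0] by (simp del: of_real_mult of_real_divide)
      ultimately show ?thesis using \<sigma> by (simp add: norm_mult abs_mult del: of_real_mult of_real_divide)
    qed
    have "cmod ((CLINT x|M. iexp (t * (S x / \<sigma>))) - (CLINT x|M. iexp (t * (N x / \<sigma>)))) =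
      cmod (CLINT x|M. iexp (t * (S x / \<sigma>)) - iexp (t * (N x / \<sigma>)))"
      by (subst Bochner_Integration.integral_diff[OF iS iN]) simp
    also have "\<dots> \<le> expectation (\<lambda>x. cmod (iexp (t * (S x / \<sigma>)) - iexp (t * (N x / \<sigma>))))"
      by (rule integral_norm_bound)
    also have "\<dots> \<le> expectation (\<lambda>x. \<bar>t\<bar> / \<sigma> * \<bar>R x\<bar>)"
      using iS iN intR by (intro integral_mono b integrable_norm Bochner_Integration.integrable_diff integrable_mult_right)
    also have "\<dots> = \<bar>t\<bar> / \<sigma> * expectation (\<lambda>x. \<bar>R x\<bar>)" by simp
    also have "\<dots> \<le> \<bar>t\<bar> / \<sigma> * H" using R1 CH \<sigma> by (intro mult_left_mono) auto
    also have "\<dots> = u * \<bar>t\<bar>" using \<sigma> by (simp add: H)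
    finally show ?thesis .
  qed
  have "cmod ((CLINT x|M. iexp (t * (S x / \<sigma>))) - exp (- t\<^sup>2 / 2)) \<le>
     u * \<bar>t\<bar> + (6 * \<bar>t\<bar> ^ 3 * (2 * u) + (2 + t\<^sup>2 * exp (3 * t\<^sup>2 / 2)) * (11 * u))"
    using norm_triangle_mono[OF c2 c1] by simp
  then show ?thesis by (simp add: algebra_simps)
qed

end

subsection \<open>Markov chains and maximal correlation\<close>

text \<open>Clipping the conditional expectation to \<open>[- K, K]\<close> changes it on a null set
  only, since it inherits the bounds of \<open>h\<close> almost everywhere. The result is a version
  bounded at every point.\<close>

lemma (in prob_space) bounded_cond_exp:
  assumes sub: "subalgebra M G" and h: "h \<in> bdd_meas M" "\<And>x. \<bar>h x\<bar> \<le> K"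
  obtains h' where "h' \<in> bdd_meas G" "\<And>x. \<bar>h' x\<bar> \<le> K" "AE x in M. h' x = real_cond_exp M G h x"
    "\<And>g. g \<in> bdd_meas G \<Longrightarrow> expectation (\<lambda>x. g x * h' x) = expectation (\<lambda>x. g x * h x)"
proof
  interpret finite_measure_subalgebra M G by standard (rule sub)
  have K0: "0 \<le> K" using h(2)[of undefined] by linarith
  have hi: "integrable M h" and hm: "h \<in> borel_measurable M" using h bdd_meas_measurable by auto
  let ?h = "\<lambda>x. max (- K) (min K (real_cond_exp M G h x))"
  show bd: "\<bar>?h x\<bar> \<le> K" for x using K0 by auto
  show hG: "?h \<in> bdd_meas G" by (rule bdd_measI[OF _ bd]) measurable
  have le: "AE x in M. h x \<le> K" and ge: "AE x in M. h x \<ge> - K"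
    using h(2) by (auto simp: abs_le_iff intro!: AE_I2) (metis minus_le_iff)
  show ae: "AE x in M. ?h x = real_cond_exp M G h x"
    using real_cond_exp_le_c[OF hi le] real_cond_exp_ge_c[OF hi ge] by eventually_elim auto
  fix g assume g: "g \<in> bdd_meas G"
  have gM: "g \<in> bdd_meas M" by (rule bdd_meas_subalgebra[OF sub g])
  have hM: "?h \<in> bdd_meas M" by (rule bdd_meas_subalgebra[OF sub hG])
  have "expectation (\<lambda>x. g x * ?h x) = expectation (\<lambda>x. g x * real_cond_exp M G h x)"
    using ae gM hM
    by (intro integral_cong_AE) (auto dest: bdd_meas_measurable elim!: eventually_mono)
  also have "\<dots> = expectation (\<lambda>x. g x * h x)"
    using gM h(1) g by (intro real_cond_exp_intg) (auto dest: bdd_meas_measurable)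
  finally show "expectation (\<lambda>x. g x * ?h x) = expectation (\<lambda>x. g x * h x)" .
qed

text \<open>
  The Markov property is only assumed for events of \<open>H\<close>. If \<open>g'\<close> is the projection of \<open>g\<close> to
  \<open>G\<close>, it says that \<open>g - g'\<close> is orthogonal to these events, so its conditional expectation given
  \<open>H\<close> vanishes and it is orthogonal to all of \<open>H\<close>.
\<close>

lemma (in prob_space) markov_projection:
  assumes A: "subalgebra M A" and G: "subalgebra A G" and H: "subalgebra M H"
    and markov: "\<And>B. B \<in> sets H \<Longrightarrow>
      AE x in M. real_cond_exp M A (indicator B) x = real_cond_exp M G (indicator B) x"
    and h: "h \<in> bdd_meas H" "\<And>x. \<bar>h x\<bar> \<le> K"
  shows "\<exists>h'\<in>bdd_meas G. (\<forall>x. \<bar>h' x\<bar> \<le> K) \<and>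
    (\<forall>g\<in>bdd_meas A. expectation (\<lambda>x. g x * h x) = expectation (\<lambda>x. g x * h' x))"
proof -
  have GM: "subalgebra M G" using A G by (auto simp: subalgebra_def)
  interpret A: finite_measure_subalgebra M A by standard (rule A)
  interpret G: finite_measure_subalgebra M G by standard (rule GM)
  interpret H: finite_measure_subalgebra M H by standard (rule H)
  have hM: "h \<in> bdd_meas M" by (rule bdd_meas_subalgebra[OF H h(1)])
  obtain h' where h': "h' \<in> bdd_meas G" "\<And>x. \<bar>h' x\<bar> \<le> K"
    and h'_proj: "\<And>g. g \<in> bdd_meas G \<Longrightarrow> expectation (\<lambda>x. g x * h' x) = expectation (\<lambda>x. g x * h x)"
    using bounded_cond_exp[OF GM hM h(2)] by metis
  have "expectation (\<lambda>x. g x * h x) = expectation (\<lambda>x. g x * h' x)" if g: "g \<in> bdd_meas A" for g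
  proof -
    have gM: "g \<in> bdd_meas M" by (rule bdd_meas_subalgebra[OF A g])
    obtain L where L: "\<And>x. \<bar>g x\<bar> \<le> L" using g by (auto simp: bdd_meas_def)
    obtain g' where g': "g' \<in> bdd_meas G"
      and g'_proj: "\<And>f. f \<in> bdd_meas G \<Longrightarrow> expectation (\<lambda>x. f x * g' x) = expectation (\<lambda>x. f x * g x)"
      using bounded_cond_exp[OF GM gM L] by metis
    have g'M: "g' \<in> bdd_meas M" by (rule bdd_meas_subalgebra[OF GM g'])
    define u where "u x = g x - g' x" for x
    have uM: "u \<in> bdd_meas M" unfolding u_def[abs_def] by (intro bdd_meas_diff gM g'M)
    \<comment> \<open>The Markov property replaces the projection of the event onto \<open>A\<close>
      by its projection \<open>b\<close> onto \<open>G\<close>. As projection onto \<open>G\<close>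
      is symmetric, it can be moved from the event to \<open>g\<close>.\<close>
    have event: "expectation (\<lambda>x. g x * indicator B x) = expectation (\<lambda>x. g' x * indicator B x)"
      if B: "B \<in> sets H" for B
    proof -
      have [measurable]: "B \<in> sets M" using B H by (auto simp: subalgebra_def)
      have BM: "indicator B \<in> bdd_meas M"
        by (rule bdd_measI[where K = 1]) (auto simp: indicator_def)
      have B1: "\<bar>indicator B x :: real\<bar> \<le> 1" for x by (simp add: indicator_def)
      obtain b where b: "b \<in> bdd_meas G" "AE x in M. b x = real_cond_exp M G (indicator B) x"
        "\<And>f. f \<in> bdd_meas G \<Longrightarrow> expectation (\<lambda>x. f x * b x) = expectation (\<lambda>x. f x * indicator B x)"
        using bounded_cond_exp[OF GM BM B1] by metis
      have bM: "b \<in> bdd_meas M" by (rule bdd_meas_subalgebra[OF GM b(1)])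
      have "expectation (\<lambda>x. g x * indicator B x) = expectation (\<lambda>x. g x * real_cond_exp M A (indicator B) x)"
        using g bdd_meas_integrable[OF bdd_meas_mult[OF gM BM]]
        by (intro A.real_cond_exp_intg(2)[symmetric]) (auto dest: bdd_meas_measurable)
      also have "\<dots> = expectation (\<lambda>x. g x * b x)"
      proof (rule integral_cong_AE)
        show "AE x in M. g x * real_cond_exp M A (indicator B) x = g x * b x"
          using markov[OF B] b(2) by eventually_elim simp
      qed (use gM bM in \<open>auto dest!: bdd_meas_measurable\<close>)
      also have "\<dots> = expectation (\<lambda>x. b x * g' x)" using g'_proj[OF b(1)] by (simp add: mult.commute)
      also have "\<dots> = expectation (\<lambda>x. g' x * indicator B x)" using b(3)[OF g'] by (simp add: mult.commute)
      finally show ?thesis .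
    qed
    have "AE x in M. real_cond_exp M H u x = 0"
    proof (rule H.real_cond_exp_charact)
      fix B assume B: "B \<in> sets H"
      then have "B \<in> sets M" using H by (auto simp: subalgebra_def)
      then have BM: "indicator B \<in> bdd_meas M"
        by (intro bdd_measI[where K = 1]) (auto simp: indicator_def)
      have i: "integrable M (\<lambda>x. g x * indicator B x)" "integrable M (\<lambda>x. g' x * indicator B x)"
        by (intro bdd_meas_integrable bdd_meas_mult gM g'M BM)+
      have "(\<integral>x\<in>B. u x \<partial>M) = expectation (\<lambda>x. g x * indicator B x - g' x * indicator B x)"
        by (simp add: set_lebesgue_integral_def u_def algebra_simps)
      also have "\<dots> = 0" using i event[OF B] by simp
      finally show "(\<integral>x\<in>B. u x \<partial>M) = (\<integral>x\<in>B. 0 \<partial>M)" by (simp add: set_lebesgue_integral_def)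
    qed (use uM in auto)
    moreover have "expectation (\<lambda>x. h x * real_cond_exp M H u x) = expectation (\<lambda>x. h x * u x)"
      using h uM hM by (intro H.real_cond_exp_intg) (auto dest: bdd_meas_measurable)
    moreover have "expectation (\<lambda>x. h x * real_cond_exp M H u x) = 0"
      if "AE x in M. real_cond_exp M H u x = 0"
    proof (rule integral_eq_zero_AE)
      show "AE x in M. h x * real_cond_exp M H u x = 0" using that by eventually_elim simp
    qed
    ultimately have "expectation (\<lambda>x. h x * u x) = 0" by simp
    moreover have "expectation (\<lambda>x. h x * u x) = expectation (\<lambda>x. g x * h x) - expectation (\<lambda>x. g' x * h x)"
    proof -
      have i: "integrable M (\<lambda>x. g x * h x)" "integrable M (\<lambda>x. g' x * h x)"
        by (intro bdd_meas_integrable bdd_meas_mult gM g'M hM)+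
      have "expectation (\<lambda>x. h x * u x) = expectation (\<lambda>x. g x * h x - g' x * h x)"
        by (simp add: u_def algebra_simps)
      then show ?thesis using i by simp
    qed
    ultimately have "expectation (\<lambda>x. g x * h x) = expectation (\<lambda>x. g' x * h x)" by simp
    also have "\<dots> = expectation (\<lambda>x. h' x * g' x)" using h'_proj[OF g'] by (simp add: mult.commute)
    also have "\<dots> = expectation (\<lambda>x. g x * h' x)" using g'_proj[OF h'(1)] by (simp add: mult.commute)
    finally show ?thesis .
  qed
  then show ?thesis using h' by blast
qed

section \<open>Sigma-algebras generated by the chain\<close>

lemma sigma_alg_of_family_generator:
  "{\<xi> i -` A \<inter> space M | i A. i \<in> I \<and> A \<in> sets S} \<subseteq> Pow (space M)"
  by auto

lemma space_sigma_alg_of_family [simp]: "space (sigma_alg_of_family M S \<xi> I) = space M"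
  unfolding sigma_alg_of_family_def by (rule space_measure_of[OF sigma_alg_of_family_generator])

lemma sets_sigma_alg_of_family:
  "sets (sigma_alg_of_family M S \<xi> I) =
    sigma_sets (space M) {\<xi> i -` A \<inter> space M | i A. i \<in> I \<and> A \<in> sets S}"
  unfolding sigma_alg_of_family_def by (rule sets_measure_of[OF sigma_alg_of_family_generator])

lemma subalgebra_sigma_alg_of_family:
  assumes "\<And>i. i \<in> I \<Longrightarrow> \<xi> i \<in> measurable M S"
  shows "subalgebra M (sigma_alg_of_family M S \<xi> I)"
proof -
  have "{\<xi> i -` A \<inter> space M | i A. i \<in> I \<and> A \<in> sets S} \<subseteq> sets M"
    using assms by (auto intro: measurable_sets)
  then show ?thesis
    by (auto simp: subalgebra_def sets_sigma_alg_of_family dest!: sets.sigma_sets_subset)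
qed

lemma subalgebra_sigma_alg_of_family_mono:
  "I \<subseteq> J \<Longrightarrow> subalgebra (sigma_alg_of_family M S \<xi> J) (sigma_alg_of_family M S \<xi> I)"
  unfolding subalgebra_def sets_sigma_alg_of_family space_sigma_alg_of_family
  by (intro conjI refl sigma_sets_mono') auto

lemma subalgebra_sigma_alg_of_family_vimage:
  assumes "i \<in> I" "\<xi> i \<in> measurable M S"
  shows "subalgebra (sigma_alg_of_family M S \<xi> I) (vimage_algebra (space M) (\<xi> i) S)"
proof -
  have "sets (vimage_algebra (space M) (\<xi> i) S) = {\<xi> i -` A \<inter> space M | A. A \<in> sets S}"
    using assms by (intro sets_vimage_algebra2) (auto simp: measurable_space)
  then show ?thesis using assms(1)
    by (auto simp: subalgebra_def sets_sigma_alg_of_family intro: sigma_sets.Basic)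
qed

text \<open>The empty family, the past at time 0, generates the trivial sigma-algebra, so a level
  set is empty or the whole space.\<close>

lemma bdd_meas_sigma_alg_of_empty_family:
  assumes h: "h \<in> bdd_meas (sigma_alg_of_family M S \<xi> {})" and x: "x \<in> space M" "y \<in> space M"
  shows "h x = h y"
proof -
  let ?B = "h -` {h y} \<inter> space (sigma_alg_of_family M S \<xi> {})"
  have "?B \<in> sets (sigma_alg_of_family M S \<xi> {})"
    using h by (intro measurable_sets[of h _ borel]) (auto simp: bdd_meas_def)
  then have "?B \<in> {{}, space M}" by (simp add: sets_sigma_alg_of_family sigma_sets_empty_eq)
  then show ?thesis using x by auto
qed

section \<open>Maximal correlation of neighbouring states\<close>

lemma (in prob_space) bdd_meas_L2_space:
  assumes "subalgebra M G" "g \<in> bdd_meas G"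
  shows "g \<in> L2_space M G"
  using assms bdd_meas_subalgebra[OF assms]
  by (auto simp: L2_space_def bdd_meas_measurable)

lemma (in prob_space) abs_corr_le_max_corr:
  assumes "subalgebra M G" "subalgebra M H" "g \<in> L2_space M G" "h \<in> L2_space M H"
  shows "\<bar>corr M g h\<bar> \<le> max_corr M G H"
proof -
  have "bdd_above ((\<lambda>(f, g). \<bar>corr M f g\<bar>) ` (L2_space M G \<times> L2_space M H))"
    using abs_corr_le_1[OF prob_space_axioms assms(1,2)] by (intro bdd_aboveI[where M = 1]) auto
  from cSUP_upper[OF _ this, of "(g, h)"] show ?thesis
    using assms by (simp add: max_corr_def)
qed

text \<open>For centred functions the correlation is the expectation of the product divided by both
  norms. If a norm vanishes, the quotient says nothing, but then the product is 0 almost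
  everywhere.\<close>

lemma (in prob_space) expectation_mult_le_max_corr:
  assumes sub: "subalgebra M G" "subalgebra M H" and g: "g \<in> bdd_meas G" and h: "h \<in> bdd_meas H"
    and mean: "expectation g = 0" "expectation h = 0"
  shows "expectation (\<lambda>x. g x * h x) \<le>
    max_corr M G H * sqrt (expectation (\<lambda>x. (g x)\<^sup>2)) * sqrt (expectation (\<lambda>x. (h x)\<^sup>2))"
proof -
  let ?a = "sqrt (expectation (\<lambda>x. (g x)\<^sup>2))" and ?b = "sqrt (expectation (\<lambda>x. (h x)\<^sup>2))"
  have M: "g \<in> bdd_meas M" "h \<in> bdd_meas M" using sub g h bdd_meas_subalgebra by auto
  have zero: "AE x in M. f x = 0" if "f \<in> bdd_meas M" "expectation (\<lambda>x. (f x)\<^sup>2) = 0" for f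
    using that integral_nonneg_eq_0_iff_AE[of M "\<lambda>x. (f x)\<^sup>2"] by auto
  show ?thesis
  proof (cases "?a * ?b = 0")
    case True
    then have "AE x in M. g x * h x = 0" using zero[OF M(1)] zero[OF M(2)] by (auto elim!: eventually_mono)
    then have "expectation (\<lambda>x. g x * h x) = 0" by (rule integral_eq_zero_AE)
    then show ?thesis using True by (auto simp: mult.assoc)
  next
    case False
    have "0 \<le> ?a" "0 \<le> ?b" by auto
    with False have pos: "0 < ?a * ?b" by (metis mult_nonneg_nonneg order_le_less)
    have "\<bar>corr M g h\<bar> \<le> max_corr M G H"
      using sub g h by (intro abs_corr_le_max_corr bdd_meas_L2_space)
    moreover have "corr M g h = expectation (\<lambda>x. g x * h x) / (?a * ?b)"
      by (simp add: corr_def covariance_def mean)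
    ultimately have "expectation (\<lambda>x. g x * h x) / (?a * ?b) \<le> max_corr M G H" by linarith
    then show ?thesis using pos by (simp add: pos_divide_le_eq mult.assoc)
  qed
qed

text \<open>Time 0 is adjoined with the trivial past as its present. In the step from 0 to 1 both
  conditional expectations refer to the same sigma-algebra, and centred functions of time 0 vanish
  on the space, so \<open>max_corr\<close> is needed only for true neighbours,
  \<open>1 \<le> k < n\<close>.\<close>

lemma markov_chain_rho_mixing_chain:
  fixes M :: "'a measure" and S :: "'b measure" and \<xi> :: "nat \<Rightarrow> 'a \<Rightarrow> 'b"
  defines "F \<equiv> \<lambda>k. sigma_alg_of_family M S \<xi> {1..k}"
  defines "G \<equiv> \<lambda>k. if k = 0 then F 0 else vimage_algebra (space M) (\<xi> k) S"
  assumes "prob_space M" and chain: "markov_chain M S n \<xi>" and rho: "chain_rho M S n \<xi> < 1"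
  shows "rho_mixing_chain M F G n (chain_rho M S n \<xi>)"
proof -
  interpret prob_space M by fact
  have meas: "\<xi> i \<in> measurable M S" if "i \<in> {1..n}" for i
    using chain that by (simp add: markov_chain_def)
  have sub_F: "subalgebra M (F k)" if "k \<le> n" for k
    unfolding F_def using that by (intro subalgebra_sigma_alg_of_family meas) auto
  have sub_G: "subalgebra (F k) (G k)" if "k \<le> n" for k
  proof (cases "k = 0")
    case True
    then show ?thesis by (simp add: G_def subalgebra_def)
  next
    case False
    then show ?thesis unfolding G_def F_def using that
      by (simp, intro subalgebra_sigma_alg_of_family_vimage meas) auto
  qed
  have sub_GM: "subalgebra M (G k)" if "k \<le> n" for k
    using sub_F[OF that] sub_G[OF that] by (auto simp: subalgebra_def)
  have trivial: "h x = 0" if h: "h \<in> bdd_meas (G 0)" "expectation h = 0" and x: "x \<in> space M" for h x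
  proof -
    have "h \<in> bdd_meas (sigma_alg_of_family M S \<xi> {})" using h(1) by (simp add: G_def F_def)
    from bdd_meas_sigma_alg_of_empty_family[OF this _ x] have "h y = h x" if "y \<in> space M" for y
      using that .
    then have "expectation h = expectation (\<lambda>_. h x)"
      by (rule Bochner_Integration.integral_cong[OF refl])
    then show ?thesis using h(2) by (simp add: prob_space)
  qed
  have max_corr_le: "max_corr M (G k) (G (Suc k)) \<le> chain_rho M S n \<xi>" if "1 \<le> k" "k < n" for k
  proof -
    have "chain_rho M S n \<xi> = (MAX s\<in>{1..n - 1}. max_corr M
             (vimage_algebra (space M) (\<xi> s) S) (vimage_algebra (space M) (\<xi> (Suc s)) S))"
      using that by (simp add: chain_rho_def)
    moreover have "max_corr M (G k) (G (Suc k)) = max_corr M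
             (vimage_algebra (space M) (\<xi> k) S) (vimage_algebra (space M) (\<xi> (Suc k)) S)"
      using that by (simp add: G_def)
    ultimately show ?thesis using that by auto
  qed
  have rho0: "0 \<le> chain_rho M S n \<xi>"
  proof (cases "n \<le> 1")
    case True
    then show ?thesis by (simp add: chain_rho_def)
  next
    case False
    have "0 \<le> \<bar>corr M (\<lambda>_. 0) (\<lambda>_. 0)\<bar>" by simp
    also have "\<dots> \<le> max_corr M (G 1) (G (Suc 1))"
      using False by (intro abs_corr_le_max_corr sub_GM zero_in_L2_space) auto
    also have "\<dots> \<le> chain_rho M S n \<xi>" using False by (intro max_corr_le) auto
    finally show ?thesis .
  qed
  show ?thesis
  proof
    show "subalgebra M (F k)" if "k \<le> n" for k by (rule sub_F[OF that])
    show "subalgebra (F (Suc k)) (F k)" if "k < n" for k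
      unfolding F_def by (rule subalgebra_sigma_alg_of_family_mono) auto
    show "subalgebra (F k) (G k)" if "k \<le> n" for k by (rule sub_G[OF that])
    show "expectation (\<lambda>x. (h x)\<^sup>2) = 0" if "h \<in> bdd_meas (G 0)" "expectation h = 0" for h
    proof -
      have "expectation (\<lambda>x. (h x)\<^sup>2) = expectation (\<lambda>_. 0)"
        by (intro Bochner_Integration.integral_cong) (auto simp: trivial[OF that])
      then show ?thesis by simp
    qed
    show "\<exists>h'\<in>bdd_meas (G k). (\<forall>x. \<bar>h' x\<bar> \<le> K) \<and>
        (\<forall>g\<in>bdd_meas (F k). expectation (\<lambda>x. g x * h x) = expectation (\<lambda>x. g x * h' x))"
      if k: "k < n" and h: "h \<in> bdd_meas (G (Suc k))" "\<And>x. \<bar>h x\<bar> \<le> K" for k h K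
    proof (rule markov_projection[OF _ _ _ _ h])
      show "AE x in M. real_cond_exp M (F k) (indicator B) x = real_cond_exp M (G k) (indicator B) x"
        if B: "B \<in> sets (G (Suc k))" for B
      proof (cases "k = 0")
        case True
        then show ?thesis by (simp add: G_def)
      next
        case False
        have "sets (G (Suc k)) = {\<xi> (Suc k) -` A \<inter> space M | A. A \<in> sets S}"
          using k measurable_space[OF meas[of "Suc k"]] by (simp add: G_def sets_vimage_algebra2 Pi_iff)
        then obtain A where "A \<in> sets S" "B = \<xi> (Suc k) -` A \<inter> space M" using B by auto
        then show ?thesis using chain False k by (simp add: markov_chain_def F_def G_def)
      qed
    qed (use k in \<open>auto intro: sub_F sub_G sub_GM\<close>)
    show "expectation (\<lambda>x. g x * h x) \<le> chain_rho M S n \<xi> *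
        sqrt (expectation (\<lambda>x. (g x)\<^sup>2)) * sqrt (expectation (\<lambda>x. (h x)\<^sup>2))"
      if k: "k < n" and g: "g \<in> bdd_meas (G k)" and h: "h \<in> bdd_meas (G (Suc k))"
        and mean: "expectation g = 0" "expectation h = 0" for k g h
    proof (cases "k = 0")
      case True
      then have "expectation (\<lambda>x. g x * h x) = expectation (\<lambda>_. 0)"
        using trivial[of g] g mean by (intro Bochner_Integration.integral_cong) auto
      then show ?thesis using rho0 by simp
    next
      case False
      have "expectation (\<lambda>x. g x * h x) \<le> max_corr M (G k) (G (Suc k)) *
          sqrt (expectation (\<lambda>x. (g x)\<^sup>2)) * sqrt (expectation (\<lambda>x. (h x)\<^sup>2))"
        using k by (intro expectation_mult_le_max_corr sub_GM g h mean) auto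
      also have "\<dots> \<le> chain_rho M S n \<xi> *
          sqrt (expectation (\<lambda>x. (g x)\<^sup>2)) * sqrt (expectation (\<lambda>x. (h x)\<^sup>2))"
        using False k by (intro mult_right_mono max_corr_le) auto
      finally show ?thesis .
    qed
  qed (use rho rho0 in auto)
qed

section \<open>Truncation level and rate\<close>

text \<open>Since \<open>ln x = ln y + 3 |ln l| + 2 ln L\<close> with \<open>|ln l| = L - 1\<close>
  and \<open>ln L \<le> L - 1\<close>, the numerator is at most
  \<open>ln y + 5 L \<le> L (ln y + 5)\<close>; the factor \<open>L\<close> cancels against
  \<open>sqrt (l^3 x) = L sqrt y\<close>.\<close>

lemma ln_plus_one_le:
  fixes x l :: real
  defines "L \<equiv> 1 + \<bar>ln l\<bar>"
  defines "y \<equiv> l ^ 3 * x / L\<^sup>2"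
  assumes x: "x \<ge> 1" and l: "0 < l" "l \<le> 1" and y: "y \<ge> 1"
  shows "(ln x + 1) / sqrt (l ^ 3 * x) \<le> (ln y + 5) / sqrt y"
proof -
  have L: "L \<ge> 1" "L = 1 - ln l" using l by (simp_all add: L_def)
  have "ln y = 3 * ln l + ln x - 2 * ln L"
    using x l L(1) by (simp add: y_def ln_div ln_mult ln_realpow)
  moreover have "ln L \<le> L - 1" using L by (intro ln_le_minus_one) auto
  ultimately have "ln x + 1 \<le> ln y + 5 * L" using L by simp
  also have "\<dots> \<le> L * (ln y + 5)"
  proof -
    have "1 * ln y \<le> L * ln y" using L(1) y by (intro mult_right_mono) auto
    then show ?thesis by (simp add: distrib_left mult.commute[of _ 5] del: mult_le_cancel_right1 mult_le_cancel_right2)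
  qed
  finally have *: "ln x + 1 \<le> L * (ln y + 5)" .
  have "l ^ 3 * x = y * L\<^sup>2" using L by (simp add: y_def)
  then have "sqrt (l ^ 3 * x) = sqrt y * L" using L by (simp add: real_sqrt_mult)
  then have "(ln x + 1) / sqrt (l ^ 3 * x) \<le> (L * (ln y + 5)) / (sqrt y * L)"
    using * L(1) y by (simp only:) (intro divide_right_mono, auto)
  also have "\<dots> = (ln y + 5) / sqrt y" using L by simp
  finally show ?thesis .
qed

lemma ln_plus_const_over_sqrt_tendsto_0:
  "((\<lambda>y::real. (ln y + c) / sqrt y) \<longlongrightarrow> 0) at_top"
proof -
  have inv: "((\<lambda>z::real. inverse z) \<longlongrightarrow> 0) at_top"
    by (rule tendsto_inverse_0_at_top[OF filterlim_ident])
  have "((\<lambda>z::real. 2 * (ln z / z) + c * inverse z) \<longlongrightarrow> 2 * 0 + c * 0) at_top"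
    by (intro tendsto_intros ln_x_over_x_tendsto_0 inv)
  then have "((\<lambda>y::real. 2 * (ln (sqrt y) / sqrt y) + c * inverse (sqrt y)) \<longlongrightarrow> 0) at_top"
    using filterlim_compose[OF _ sqrt_at_top] by force
  then show ?thesis
    by (rule Lim_transform_eventually)
      (auto intro!: eventually_mono[OF eventually_gt_at_top[of 0]] simp: ln_sqrt field_simps)
qed

text \<open>The choice of \<open>m\<close> gives
  \<open>(1 - l)^m \<le> exp (- l m) \<le> 1 / x^2\<close>. Rounding up and the added 1 cost at most
  2, which is at most \<open>2 / l\<close>.\<close>

lemma truncation_level:
  fixes l x :: real
  assumes l: "0 < l" "l \<le> 1" and x: "x \<ge> 1"
  defines "m \<equiv> nat \<lceil>2 * ln x / l\<rceil>"
  shows "x\<^sup>2 * (1 - l) ^ m \<le> 1" "real m + 1 \<le> 2 * (ln x + 1) / l"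
proof -
  have pos: "0 \<le> 2 * ln x / l" using l x by simp
  have m: "2 * ln x / l \<le> real m" "real m \<le> 2 * ln x / l + 1"
    using pos unfolding m_def by linarith+
  have "(1 - l) ^ m \<le> exp (- l) ^ m"
    using l exp_ge_add_one_self[of "- l"] by (intro power_mono) auto
  also have "\<dots> = exp (- (l * real m))" by (simp add: mult.commute flip: exp_of_nat_mult)
  also have "\<dots> \<le> exp (- (2 * ln x))" using m(1) l by (simp add: field_simps)
  also have "\<dots> = 1 / x\<^sup>2"
  proof -
    have "exp (- (2 * ln x)) = inverse ((exp (ln x))\<^sup>2)" by (simp only: exp_minus exp_double)
    then show ?thesis using x by (simp add: inverse_eq_divide)
  qed
  finally show "x\<^sup>2 * (1 - l) ^ m \<le> 1" using x by (simp add: field_simps)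
  have "real m + 1 \<le> 2 * ln x / l + 2" using m by simp
  moreover have "2 \<le> 2 / l" using l by (simp add: field_simps)
  ultimately have "real m + 1 \<le> 2 * ln x / l + 2 / l" by linarith
  then show "real m + 1 \<le> 2 * (ln x + 1) / l" by (simp add: add_divide_distrib distrib_left)
qed

text \<open>Levy's continuity theorem reduces the claim to characteristic functions at a fixed
  \<open>t\<close>, where an explicit bound holds for every large \<open>n\<close>.\<close>

theorem corollary3:
  fixes M :: "'a measure" and S :: "'b measure"
    and \<xi> :: "nat \<Rightarrow> nat \<Rightarrow> 'a \<Rightarrow> 'b"
    and f :: "nat \<Rightarrow> nat \<Rightarrow> 'b \<Rightarrow> real"
    and C c :: real
  defines "X \<equiv> \<lambda>n i \<omega>. f n i (\<xi> n i \<omega>)"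
  defines "lam \<equiv> \<lambda>n. 1 - chain_rho M S n (\<xi> n)"
  defines "sig \<equiv> \<lambda>n. sqrt (prob_space.variance M (\<lambda>\<omega>. \<Sum>i=1..n. X n i \<omega>))"
  defines "b \<equiv> \<lambda>n. sqrt (\<Sum>i=1..n. prob_space.variance M (X n i))"
  assumes "prob_space M"
    and "\<And>n. n \<ge> 1 \<Longrightarrow> markov_chain M S n (\<xi> n)"
    and "\<And>n i. n \<ge> 1 \<Longrightarrow> i \<in> {1..n} \<Longrightarrow> f n i \<in> borel_measurable S"
    and "\<And>n i. n \<ge> 1 \<Longrightarrow> i \<in> {1..n} \<Longrightarrow> prob_space.expectation M (X n i) = 0"
    and "\<And>n i. n \<ge> 1 \<Longrightarrow> i \<in> {1..n} \<Longrightarrow> integrable M (\<lambda>\<omega>. (X n i \<omega>)\<^sup>2)"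
    and "\<And>n. n \<ge> 1 \<Longrightarrow> lam n * b n > 0"
    and "C > 0" and "c > 0"
    and "\<And>n. n \<ge> 1 \<Longrightarrow> AE \<omega> in M. (MAX i\<in>{1..n}. \<bar>X n i \<omega>\<bar>) \<le> C"
    and "\<And>n i. n \<ge> 1 \<Longrightarrow> i \<in> {1..n} \<Longrightarrow> prob_space.variance M (X n i) \<ge> c"
    and "filterlim (\<lambda>n. lam n ^ 3 * real n / (1 + \<bar>ln (lam n)\<bar>)\<^sup>2) at_top sequentially"
  shows "weak_conv_m (\<lambda>n. distr M borel (\<lambda>\<omega>. (\<Sum>i=1..n. X n i \<omega>) / sig n))
           std_normal_distribution"
proof -
  interpret prob_space M by fact
  note chain = assms(6) and f = assms(7) and mean = assms(8) and lam_b = assms(10)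
    and C = assms(11) and c = assms(12) and bound = assms(13) and var = assms(14) and lim = assms(15)
  have \<xi>: "\<xi> n i \<in> measurable M S" if "i \<in> {1..n}" for n i
    using chain[of n] that by (auto simp: markov_chain_def)
  have X_meas: "X n i \<in> borel_measurable M" if "i \<in> {1..n}" for n i
    unfolding X_def using measurable_compose[OF \<xi>[OF that] f[OF _ that]] that by simp
  define T where "T n x = (\<Sum>i=1..n. X n i x) / sig n" for n x
  have sum_meas: "(\<lambda>x. \<Sum>i=1..n. X n i x) \<in> borel_measurable M" for n
    by (intro borel_measurable_sum X_meas)
  have T_meas [measurable]: "T n \<in> borel_measurable M" for n
    unfolding T_def[abs_def] by (intro borel_measurable_divide sum_meas borel_measurable_const)
  define y where "y n = lam n ^ 3 * real n / (1 + \<bar>ln (lam n)\<bar>)\<^sup>2" for n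
  \<comment> \<open>An upper bound for \<open>C (m + 1) / sig n\<close>: from
    \<open>m + 1 \<le> 2 (ln n + 1) / lam n\<close> and
    \<open>sig n \<ge> sqrt (lam n * n * c) / 2\<close> one gets \<open>4 C / sqrt c\<close> times
    \<open>(ln n + 1) / sqrt (lam n ^ 3 * n)\<close>, which is then estimated through
    \<open>y n\<close>.\<close>
  define u where "u n = 4 * C / sqrt c * ((ln (y n) + 5) / sqrt (y n))" for n
  define Kt where "Kt t = \<bar>t\<bar> + 12 * \<bar>t\<bar> ^ 3 + 11 * (2 + t\<^sup>2 * exp (3 * t\<^sup>2 / 2))" for t :: real
  have char_le: "cmod (char (distr M borel (T n)) t - exp (- t\<^sup>2 / 2)) \<le> u n * Kt t"
    if n: "n \<ge> 1" and y1: "y n \<ge> 1" and u_le: "u n \<le> 1 / 2" for n t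
  proof -
    let ?r = "chain_rho M S n (\<xi> n)"
    \<comment> \<open>Clipping makes the bound by \<open>C\<close> hold at every point and keeps
      \<open>Y i\<close> a function of \<open>\<xi> n i\<close>. Almost surely nothing changes, so
      moments and characteristic functions are the same.\<close>
    define Y where "Y i x = max (- C) (min C (X n i x))" for i x
    define F where "F = (\<lambda>k. sigma_alg_of_family M S (\<xi> n) {1..k})"
    define G where "G = (\<lambda>k. if k = 0 then F 0 else vimage_algebra (space M) (\<xi> n k) S)"
    \<comment> \<open>As \<open>b n\<close> is a square root, positivity of
      \<open>lam n * b n\<close> forces \<open>lam n > 0\<close>, that is, a maximal correlation
      below 1.\<close>
    have "b n \<ge> 0" unfolding b_def by (intro real_sqrt_ge_zero sum_nonneg variance_positive)
    then have lam0: "lam n > 0" using lam_b[OF n] by (simp add: zero_less_mult_iff)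
    interpret rho_mixing_chain M F G n ?r
      unfolding F_def G_def using lam0
      by (intro markov_chain_rho_mixing_chain chain n prob_space_axioms) (simp add: lam_def)
    have lam1: "lam n \<le> 1" using r by (simp add: lam_def)
    have "AE x in M. \<forall>i\<in>{1..n}. Y i x = X n i x"
      using bound[OF n]
    proof eventually_elim
      case (elim x)
      have "\<bar>X n i x\<bar> \<le> C" if "i \<in> {1..n}" for i
        using that elim Max_ge[of "(\<lambda>i. \<bar>X n i x\<bar>) ` {1..n}" "\<bar>X n i x\<bar>"] by force
      then show ?case by (force simp: Y_def abs_le_iff max_def min_def)
    qed
    then have ae: "AE x in M. Y i x = X n i x" if "i \<in> {1..n}" for i
      using that by (auto elim!: eventually_mono)
    have sum_ae: "AE x in M. (\<Sum>i=1..n. Y i x) = (\<Sum>i=1..n. X n i x)"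
      using \<open>AE x in M. \<forall>i\<in>{1..n}. Y i x = X n i x\<close> by eventually_elim simp
    have Y_bound: "\<bar>Y i x\<bar> \<le> C" for i x using C by (auto simp: Y_def)
    have Y_G: "Y i \<in> bdd_meas (G i)" if "i \<in> {1..n}" for i
    proof (rule bdd_measI[OF _ Y_bound])
      have "\<xi> n i \<in> measurable (vimage_algebra (space M) (\<xi> n i) S) S"
        using measurable_space[OF \<xi>[OF that]] by (intro measurable_vimage_algebra1) auto
      from measurable_compose[OF this f[OF n that]]
      have [measurable]: "X n i \<in> borel_measurable (G i)" using that by (simp add: X_def G_def)
      show "Y i \<in> borel_measurable (G i)" unfolding Y_def[abs_def] by measurable
    qed
    have Y_M: "Y i \<in> bdd_meas M" if "i \<in> {1..n}" for i using G_M[OF Y_G[OF that]] that by simp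
    have Y_meas: "Y i \<in> borel_measurable M" if "i \<in> {1..n}" for i
      using Y_M[OF that] by (rule bdd_meas_measurable)
    have Y_mean: "expectation (Y i) = 0" if "i \<in> {1..n}" for i
      using integral_cong_AE[OF Y_meas[OF that] X_meas[OF that] ae[OF that]] mean[OF n that] by simp
    interpret rho_mixing_sum M F G n ?r Y C
      by standard (use Y_G Y_bound Y_mean C in auto)
    have sumY_meas: "(\<lambda>x. \<Sum>i=1..n. Y i x) \<in> borel_measurable M"
      by (intro borel_measurable_sum Y_meas)
    have "expectation (\<lambda>x. \<Sum>i=1..n. X n i x) = expectation (\<lambda>x. \<Sum>i=1..n. Y i x)"
      using sum_ae by (intro integral_cong_AE sum_meas sumY_meas) (auto elim!: eventually_mono)
    also have "\<dots> = 0"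
      using Y_M Y_mean by (subst Bochner_Integration.integral_sum) auto
    finally have sum_mean: "expectation (\<lambda>x. \<Sum>i=1..n. X n i x) = 0" .
    have EX2: "expectation (\<lambda>x. (Y i x)\<^sup>2) \<ge> c" if i: "i \<in> {1..n}" for i
    proof -
      have "c \<le> expectation (\<lambda>x. (X n i x)\<^sup>2)" using var[OF n i] mean[OF n i] by simp
      also have "\<dots> = expectation (\<lambda>x. (Y i x)\<^sup>2)"
        using ae[OF i] X_meas[OF i] Y_meas[OF i]
        by (intro integral_cong_AE) (auto elim!: eventually_mono)
      finally show ?thesis .
    qed
    have ES2: "expectation (\<lambda>x. (\<Sum>i=1..n. Y i x)\<^sup>2) = variance (\<lambda>x. \<Sum>i=1..n. X n i x)"
      unfolding sum_mean using sum_ae sum_meas sumY_meas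
      by (intro integral_cong_AE) (auto elim!: eventually_mono)
    have sig2: "(sig n)\<^sup>2 = expectation (\<lambda>x. (\<Sum>i=1..n. Y i x)\<^sup>2)"
      unfolding ES2 sig_def by (rule real_sqrt_pow2[OF variance_positive])
    have "lam n / 4 * (\<Sum>i=1..n. c) \<le> lam n / 4 * (\<Sum>i=1..n. expectation (\<lambda>x. (Y i x)\<^sup>2))"
      using lam0 EX2 by (intro mult_left_mono sum_mono) auto
    also have "\<dots> \<le> (sig n)\<^sup>2" using variance_lower_bound by (simp add: lam_def sig2)
    finally have sig2_ge: "lam n * real n * c / 4 \<le> (sig n)\<^sup>2" by (simp add: mult_ac)
    have "0 < lam n * real n * c / 4" using lam0 c n by simp
    moreover have "0 \<le> sig n" by (simp add: sig_def)
    ultimately have sig0: "0 < sig n"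
      using sig2_ge by (metis order_le_less not_le power_zero_numeral)
    have sig_ge: "sqrt (lam n * real n * c) / 2 \<le> sig n"
      using real_sqrt_le_mono[OF sig2_ge] sig0 by (simp add: real_sqrt_divide)
    define m where "m = nat \<lceil>2 * ln (real n) / lam n\<rceil>"
    have m: "(real n)\<^sup>2 * ?r ^ m \<le> 1" "real m + 1 \<le> 2 * (ln (real n) + 1) / lam n"
      using truncation_level[OF lam0 lam1, of "real n"] n by (simp_all add: m_def lam_def)
    have "C * (real m + 1) / sig n \<le> C * (2 * (ln (real n) + 1) / lam n) / (sqrt (lam n * real n * c) / 2)"
      using m(2) sig_ge C lam0 c n by (intro frac_le mult_left_mono) auto
    also have "\<dots> = 4 * C / sqrt c * ((ln (real n) + 1) / sqrt (lam n ^ 3 * real n))"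
    proof -
      have "lam n * sqrt (lam n * real n * c) = sqrt c * sqrt (lam n ^ 3 * real n)"
        using lam0 by (simp add: real_sqrt_mult power3_eq_cube)
      then show ?thesis by (simp add: mult_ac)
    qed
    also have "\<dots> \<le> u n"
      unfolding u_def y_def
      using ln_plus_one_le[OF _ lam0 lam1, of "real n"] n y1 C c
      by (intro mult_left_mono) (auto simp: y_def)
    finally have um: "C * (real m + 1) / sig n \<le> u n" .
    have "char (distr M borel (T n)) t = (CLINT x|M. iexp (t * T n x))"
      unfolding char_def by (subst integral_distr) auto
    also have "\<dots> = (CLINT x|M. iexp (t * ((\<Sum>i=1..n. Y i x) / sig n)))"
    proof (rule integral_cong_AE)
      show "AE x in M. iexp (t * T n x) = iexp (t * ((\<Sum>i=1..n. Y i x) / sig n))"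
        using sum_ae by eventually_elim (simp add: T_def)
      have [measurable]: "(\<lambda>x. \<Sum>i=1..n. Y i x) \<in> borel_measurable M" by (rule sumY_meas)
      show "(\<lambda>x. iexp (t * ((\<Sum>i=1..n. Y i x) / sig n))) \<in> borel_measurable M" by measurable
    qed measurable
    finally have "char (distr M borel (T n)) t = (CLINT x|M. iexp (t * ((\<Sum>i=1..n. Y i x) / sig n)))" .
    then have "cmod (char (distr M borel (T n)) t - exp (- t\<^sup>2 / 2)) \<le> C * (real m + 1) / sig n * Kt t"
      using char_bound[OF sig0 sig2[symmetric] m(1) order_trans[OF um u_le], of t]
      by (simp only: Kt_def)
    also have "\<dots> \<le> u n * Kt t" using um by (intro mult_right_mono) (auto simp: Kt_def)
    finally show ?thesis .
  qed
  have "filterlim y at_top sequentially" using lim by (simp add: y_def[abs_def])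
  then have "(\<lambda>n. (ln (y n) + 5) / sqrt (y n)) \<longlonglongrightarrow> 0"
    by (rule filterlim_compose[OF ln_plus_const_over_sqrt_tendsto_0])
  from tendsto_mult[OF tendsto_const[of "4 * C / sqrt c"] this] have u_lim: "u \<longlonglongrightarrow> 0"
    by (simp add: u_def[abs_def])
  have ev: "\<forall>\<^sub>F n in sequentially. n \<ge> 1 \<and> y n \<ge> 1 \<and> u n \<le> 1 / 2"
  proof -
    have "\<forall>\<^sub>F n in sequentially. y n \<ge> 1"
      using \<open>filterlim y at_top sequentially\<close> by (simp add: filterlim_at_top)
    moreover have "\<forall>\<^sub>F n in sequentially. u n < 1 / 2"
      using u_lim by (rule order_tendstoD(2)) simp
    ultimately show ?thesis using eventually_ge_at_top[of 1] by eventually_elim simp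
  qed
  show ?thesis
    unfolding T_def[symmetric]
  proof (rule levy_continuity)
    show "real_distribution (distr M borel (\<lambda>x. T n x))" for n
      by (rule real_distribution_distr) simp
    show "real_distribution std_normal_distribution" by (rule real_dist_normal_dist)
    show "(\<lambda>n. char (distr M borel (\<lambda>x. T n x)) t) \<longlonglongrightarrow> char std_normal_distribution t" for t
    proof -
      have "(\<lambda>n. u n * Kt t) \<longlonglongrightarrow> 0" using tendsto_mult_right[OF u_lim, of "Kt t"] by simp
      then have "(\<lambda>n. char (distr M borel (T n)) t - exp (- t\<^sup>2 / 2)) \<longlonglongrightarrow> 0"
        by (rule Lim_null_comparison[rotated]) (use ev char_le in \<open>auto elim!: eventually_mono\<close>)
      then show ?thesis by (simp add: char_std_normal_distribution LIM_zero_iff)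
    qed
  qed
qed

end
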